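(* For any $r$-hourglass plabic graphs $G$ and $G'$ related by a square move, $\mathrm{trip}_i(G)=\mathrm{trip}_i(G')$ for all $1\le i\le r-1$.
   Context: $r$-hourglass plabic graph: bipartite planar graph in a disk with fixed black–white coloring and positive integer edge multiplicities (an $m$-hourglass drawn as $m$ strands twisted so the clockwise order of strands agrees at both ends), internal vertices of degree $r$ counted with multiplicity, boundary vertices of simple degree one labeled $b_1,\dots,b_n$ clockwise. $\mathrm{trip}_i(G)(j)=k$ if the walk from $b_j$ along strands taking the $i$-th leftmost turn at each white vertex and $i$-th rightmost turn at each black vertex ends at $b_k$. Square move: for a face bounded by a 4-cycle $v_1v_2v_3v_4$ (clockwise) whose edges $e_i=v_iv_{i+1}$ (indices mod 4) have multiplicities $m_i$ with $m_1+m_2+m_3+m_4=r$, delete the $e_i$, add new vertices $w_1,\dots,w_4$ inside the face with $w_i$ of color opposite to $v_i$, join $v_i$ to $w_i$ by an edge of multiplicity $m_{i-1}+m_i$, and $w_i$ to $w_{i+1}$ by an edge of multiplicity $m_{i+2}$; all other edges and multiplicities unchanged. Its inverse is also a square move (and a square move may be followed by contraction moves: deleting an internal vertex of simple degree 2 joined by an $a$- and an $(r-a)$-hourglass to internal vertices $u,u'$ and identifying $u$ with $u'$). *)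

theory Defs
  imports
    "Graph_Theory.Bidirected_Digraph"
    "HOL-Combinatorics.Orbits"
    "HOL-Library.Numeral_Type"
begin

text \<open>
  A graph drawn in the disk is represented, up to planar isotopy, by a rotation system: each edge
  is a pair of mutually reverse arcs (in the style of \<^locale>\<open>bidirected_digraph\<close>), and
  \<^term>\<open>cw\<close> sends an arc to the next one in clockwise order around their common tail.
  An \<open>m\<close>-hourglass is one such edge with \<^term>\<open>mult = m\<close>.
  The boundary vertices are \<open>bvert 1, \<dots>, bvert bnum\<close>, in clockwise order.
  Parallel edges and disconnected graphs are allowed.
\<close>

record ('v, 'a) hourglass_graph = "('v, 'a) pre_digraph" +
  arev :: "'a \<Rightarrow> 'a"
  cw :: "'a \<Rightarrow> 'a"
  mult :: "'a \<Rightarrow> nat"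
  white :: "'v \<Rightarrow> bool"
  bnum :: nat
  bvert :: "nat \<Rightarrow> 'v"

definition arcs_at :: "('v, 'a) hourglass_graph \<Rightarrow> 'v \<Rightarrow> 'a set" where
  "arcs_at G v = {a \<in> arcs G. tail G a = v}"

definition boundary :: "('v, 'a) hourglass_graph \<Rightarrow> 'v set" where
  "boundary G = bvert G ` {1..bnum G}"


section \<open>Planarity in the disk\<close>

text \<open>
  The connected components of a combinatorial map with darts \<open>D\<close>, edge involution \<open>\<alpha>\<close> and vertex
  rotation \<open>\<sigma>\<close> (both permutations of the finite set \<open>D\<close>, so that the reflexive transitive closure
  below is symmetric).
\<close>

definition map_components :: "'a set \<Rightarrow> ('a \<Rightarrow> 'a) \<Rightarrow> ('a \<Rightarrow> 'a) \<Rightarrow> 'a set set" where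
  "map_components D \<alpha> \<sigma> = D // (((\<lambda>d. (d, \<alpha> d)) ` D \<union> (\<lambda>d. (d, \<sigma> d)) ` D)\<^sup>*)"

text \<open>
  Euler's formula.  A component of genus \<open>g\<close> has \<open>V - E + F = 2 - 2 g\<close>, so summing over the components
  one sees that \<open>V + F = E + 2 C\<close> holds iff every component has genus zero.
\<close>

definition planar_map :: "'a set \<Rightarrow> ('a \<Rightarrow> 'a) \<Rightarrow> ('a \<Rightarrow> 'a) \<Rightarrow> bool" where
  "planar_map D \<alpha> \<sigma> \<longleftrightarrow>
     card (orbit \<sigma> ` D) + card (orbit (\<sigma> \<circ> \<alpha>) ` D)
       = card (orbit \<alpha> ` D) + 2 * card (map_components D \<alpha> \<sigma>)"

text \<open>
  Collapsing the boundary circle of the disk (equivalently, the closed disk glued in outside it) to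
  a point turns the disk into a sphere and all boundary vertices into one vertex.  Seen from this
  vertex, the clockwise order of the boundary labels is reversed: \<open>b\<^sub>j\<close> is followed by \<open>b\<^sub>j\<^sub>-\<^sub>1\<close>, and
  \<open>b\<^sub>1\<close> by \<open>b\<^sub>n\<close>.
\<close>

definition capped_cw :: "('v, 'a) hourglass_graph \<Rightarrow> 'a \<Rightarrow> 'a" where
  "capped_cw G d =
     (if d \<in> arcs G \<and> tail G d \<in> boundary G
      then (let j = (THE j. j \<in> {1..bnum G} \<and> tail G d = bvert G j);
                k = (if j = 1 then bnum G else j - 1)
            in (THE e. e \<in> arcs G \<and> tail G e = bvert G k))
      else cw G d)"


section \<open>Hourglass plabic graphs\<close>

locale hourglass_plabic_graph =
  fin_digraph "pre_digraph.truncate G" + bidirected_digraph "pre_digraph.truncate G" "arev G"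
  for r :: nat and G :: "('v, 'a) hourglass_graph" +
  assumes cw_permutes: "cw G permutes arcs G"
    and cw_cyclic: "v \<in> verts G \<Longrightarrow> arcs_at G v \<noteq> {} \<Longrightarrow> cyclic_on (cw G) (arcs_at G v)"
    and mult_pos: "a \<in> arcs G \<Longrightarrow> mult G a > 0"
    and mult_arev: "a \<in> arcs G \<Longrightarrow> mult G (arev G a) = mult G a"
    and bipartite: "a \<in> arcs G \<Longrightarrow> white G (head G a) \<longleftrightarrow> \<not> white G (tail G a)"
    and bvert_in_verts: "j \<in> {1..bnum G} \<Longrightarrow> bvert G j \<in> verts G"
    and bvert_inj: "inj_on (bvert G) {1..bnum G}"
    and boundary_simple_degree: "v \<in> boundary G \<Longrightarrow> card (arcs_at G v) = 1"
    and internal_degree: "v \<in> verts G - boundary G \<Longrightarrow> (\<Sum>a\<in>arcs_at G v. mult G a) = r"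
    and planar_in_disk: "planar_map (arcs G) (arev G) (capped_cw G)"

text \<open>Isotopic drawings are those with isomorphic rotation systems.\<close>

definition hourglass_iso ::
    "('v, 'a) hourglass_graph \<Rightarrow> ('w, 'b) hourglass_graph \<Rightarrow> bool" where
  "hourglass_iso G H \<longleftrightarrow>
     (\<exists>f g. bij_betw f (verts G) (verts H) \<and> bij_betw g (arcs G) (arcs H) \<and>
        (\<forall>d\<in>arcs G. tail H (g d) = f (tail G d) \<and> head H (g d) = f (head G d) \<and>
           arev H (g d) = g (arev G d) \<and> cw H (g d) = g (cw G d) \<and> mult H (g d) = mult G d) \<and>
        (\<forall>v\<in>verts G. white H (f v) = white G v) \<and>
        bnum H = bnum G \<and> (\<forall>j\<in>{1..bnum G}. bvert H j = f (bvert G j)))"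


section \<open>Trips\<close>

text \<open>
  The strands of the edge of an arc \<open>a\<close> are numbered \<open>0, \<dots>, mult a - 1\<close> clockwise around the tail of
  \<open>a\<close>.  Since hourglasses are twisted so that the clockwise orders at both ends agree, the strand
  \<open>(a, p)\<close> seen from its other end is \<open>(arev a, p)\<close>.
\<close>

definition strands :: "('v, 'a) hourglass_graph \<Rightarrow> ('a \<times> nat) set" where
  "strands G = {(a, p). a \<in> arcs G \<and> p < mult G a}"

definition rev_strand :: "('v, 'a) hourglass_graph \<Rightarrow> 'a \<times> nat \<Rightarrow> 'a \<times> nat" where
  "rev_strand G = (\<lambda>(a, p). (arev G a, p))"

definition cw_strand :: "('v, 'a) hourglass_graph \<Rightarrow> 'a \<times> nat \<Rightarrow> 'a \<times> nat" where
  "cw_strand G = (\<lambda>(a, p). if Suc p < mult G a then (a, Suc p) else (cw G a, 0))"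

text \<open>
  The step from \<open>s\<close> to \<open>t\<close> traverses \<open>s\<close> from tail to head and continues along \<open>t\<close>.  For a walker
  arriving at a vertex, the leftmost turn is the strand clockwise next to the strand of arrival, so
  the \<open>i\<close>-th leftmost turn is \<open>i\<close> places clockwise and the \<open>i\<close>-th rightmost turn is \<open>i\<close> places
  counterclockwise from it.
\<close>

definition trip_step ::
    "('v, 'a) hourglass_graph \<Rightarrow> nat \<Rightarrow> 'a \<times> nat \<Rightarrow> 'a \<times> nat \<Rightarrow> bool" where
  "trip_step G i s t \<longleftrightarrow>
     s \<in> strands G \<and> t \<in> strands G \<and> head G (fst s) \<notin> boundary G \<and>
     (if white G (head G (fst s))
      then t = (cw_strand G ^^ i) (rev_strand G s)
      else (cw_strand G ^^ i) t = rev_strand G s)"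

text \<open>
  \<open>((j, p), (k, q)) \<in> strand_trip G i\<close> iff the walk that starts at \<open>b\<^sub>j\<close> along the \<open>p\<close>-th strand there
  ends at \<open>b\<^sub>k\<close>, arriving along the \<open>q\<close>-th strand there.  The relation \<open>trip G i\<close> forgets the
  strands; if all boundary edges have multiplicity one, then it is the graph of the \<open>i\<close>-th trip
  permutation of \<open>{1..bnum G}\<close>.
\<close>

definition strand_trip ::
    "('v, 'a) hourglass_graph \<Rightarrow> nat \<Rightarrow> ((nat \<times> nat) \<times> (nat \<times> nat)) set" where
  "strand_trip G i =
     {((j, p), (k, q)). j \<in> {1..bnum G} \<and> k \<in> {1..bnum G} \<and>
        (\<exists>a c. (a, p) \<in> strands G \<and> tail G a = bvert G j \<and>
               (trip_step G i)\<^sup>*\<^sup>* (a, p) (c, q) \<and> head G c = bvert G k)}"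

definition trip :: "('v, 'a) hourglass_graph \<Rightarrow> nat \<Rightarrow> (nat \<times> nat) set" where
  "trip G i = {(j, k). \<exists>p q. ((j, p), (k, q)) \<in> strand_trip G i}"


section \<open>Moves\<close>

text \<open>
  Indices are taken in the numeral type \<^typ>\<open>4\<close>, the integers modulo four.  The arc \<open>a i\<close> runs from
  \<open>v\<^sub>i\<close> to \<open>v\<^sub>i\<^sub>+\<^sub>1\<close>, the arc \<open>b i\<close> from \<open>v\<^sub>i\<close> to \<open>w\<^sub>i\<close>, and the arc \<open>c i\<close> from \<open>w\<^sub>i\<close> to \<open>w\<^sub>i\<^sub>+\<^sub>1\<close>.
  The equation \<open>cw (a (i + 1)) = arev (a i)\<close> says that the corner at \<open>v\<^sub>i\<^sub>+\<^sub>1\<close> on the right of the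
  cycle contains no further edge, i.e. that the clockwise cycle bounds a face.  (As the \<open>v\<^sub>i\<close> have
  simple degree at least two, they are internal.)
  The new arcs are pairwise distinct because they have different ends.
\<close>

definition square_move ::
    "nat \<Rightarrow> ('v, 'a) hourglass_graph \<Rightarrow> ('v, 'a) hourglass_graph \<Rightarrow> bool" where
  "square_move r G G' \<longleftrightarrow>
     hourglass_plabic_graph r G \<and> hourglass_plabic_graph r G' \<and>
     (\<exists>(a :: 4 \<Rightarrow> 'a) (w :: 4 \<Rightarrow> 'v) (b :: 4 \<Rightarrow> 'a) (c :: 4 \<Rightarrow> 'a).
        let v = (\<lambda>i. tail G (a i));
            m = (\<lambda>i. mult G (a i));
            old = range a \<union> arev G ` range a;
            new = range b \<union> range c \<union> arev G' ` (range b \<union> range c)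
        in
          range a \<subseteq> arcs G \<and> inj v \<and> (\<forall>i. head G (a i) = v (i + 1)) \<and>
          (\<forall>i. cw G (a (i + 1)) = arev G (a i)) \<and> (\<Sum>i\<in>UNIV. m i) = r \<and>
          inj w \<and> range w \<inter> verts G = {} \<and> new \<inter> arcs G = {} \<and>
          verts G' = verts G \<union> range w \<and> arcs G' = (arcs G - old) \<union> new \<and>
          (\<forall>i. tail G' (b i) = v i \<and> head G' (b i) = w i \<and> mult G' (b i) = m (i - 1) + m i) \<and>
          (\<forall>i. tail G' (c i) = w i \<and> head G' (c i) = w (i + 1) \<and> mult G' (c i) = m (i + 2)) \<and>
          (\<forall>i. cw G' (b i) = cw G (arev G (a (i - 1)))) \<and>
          (\<forall>i. cw G' (arev G' (b i)) = c i \<and> cw G' (c i) = arev G' (c (i - 1)) \<and>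
               cw G' (arev G' (c (i - 1))) = arev G' (b i)) \<and>
          (\<forall>d\<in>arcs G - old.
             tail G' d = tail G d \<and> head G' d = head G d \<and> arev G' d = arev G d \<and>
             mult G' d = mult G d \<and>
             (\<forall>i. cw G d = a i \<longrightarrow> cw G' d = b i) \<and>
             (cw G d \<notin> range a \<longrightarrow> cw G' d = cw G d)) \<and>
          (\<forall>x\<in>verts G. white G' x = white G x) \<and> (\<forall>i. white G' (w i) \<longleftrightarrow> \<not> white G (v i)) \<and>
          bnum G' = bnum G \<and> (\<forall>j\<in>{1..bnum G}. bvert G' j = bvert G j))"

text \<open>
  Deletion of a vertex \<open>z\<close> whose only arcs are \<open>x\<close>, to \<open>u\<close>, and \<open>y\<close>, to \<open>u'\<close>.  The vertex obtained by
  identifying \<open>u\<close> and \<open>u'\<close> is called \<open>u\<close>; in its clockwise order the remaining arcs of \<open>u'\<close> take the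
  place of \<open>arev x\<close>, starting with the one after \<open>arev y\<close>.
\<close>

definition contraction_move ::
    "nat \<Rightarrow> ('v, 'a) hourglass_graph \<Rightarrow> ('v, 'a) hourglass_graph \<Rightarrow> bool" where
  "contraction_move r G G' \<longleftrightarrow>
     hourglass_plabic_graph r G \<and> hourglass_plabic_graph r G' \<and>
     (\<exists>z x y.
        let u = head G x;
            u' = head G y;
            old = {x, y, arev G x, arev G y};
            merge = (\<lambda>t. if t = u' then u else t)
        in
          z \<in> verts G \<and> arcs_at G z = {x, y} \<and> x \<noteq> y \<and> u \<noteq> u' \<and>
          z \<notin> boundary G \<and> u \<notin> boundary G \<and> u' \<notin> boundary G \<and>
          verts G' = verts G - {z, u'} \<and> arcs G' = arcs G - old \<and>
          (\<forall>d\<in>arcs G - old.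
             tail G' d = merge (tail G d) \<and> head G' d = merge (head G d) \<and>
             arev G' d = arev G d \<and> mult G' d = mult G d \<and>
             cw G' d = (if cw G d = arev G x then cw G (arev G y)
                        else if cw G d = arev G y then cw G (arev G x)
                        else cw G d)) \<and>
          (\<forall>t\<in>verts G'. white G' t = white G t) \<and>
          bnum G' = bnum G \<and> (\<forall>j\<in>{1..bnum G}. bvert G' j = bvert G j))"

text \<open>
  A square move in either direction, possibly followed by contraction moves, with the result taken
  up to isotopy.
\<close>

definition square_then_contractions ::
    "nat \<Rightarrow> ('v, 'a) hourglass_graph \<Rightarrow> ('v, 'a) hourglass_graph \<Rightarrow> bool" where
  "square_then_contractions r G G' \<longleftrightarrow>
     (\<exists>H K. (square_move r G H \<or> square_move r H G) \<and>
            (contraction_move r)\<^sup>*\<^sup>* H K \<and> hourglass_iso K G')"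

definition related_by_square_move ::
    "nat \<Rightarrow> ('v, 'a) hourglass_graph \<Rightarrow> ('v, 'a) hourglass_graph \<Rightarrow> bool" where
  "related_by_square_move r G G' \<longleftrightarrow>
     square_then_contractions r G G' \<or> square_then_contractions r G' G"

end

(*
  At an internal vertex the r strands are numbered clockwise modulo r, and a trip turns by i at one
  color and by -i = r - i at the other.  A move leaves most strands in place, and the trips of the two
  graphs agree as soon as any two consecutive passages through common strands agree.
  For a contraction, the turns by k, -k, k at u, z, u' add up to the turn by k at the merged vertex.
  For a square, a trip that enters at v_j leaves at v_(j+1), v_(j+2) or v_(j+3), after at most three
  vertices of the square in G and at most five in G'.  The cases are separated by the same inequalities
  in both graphs and lead to the same exit position.
*)
theory Submission
  imports Defs
begin

section \<open>Positions around a vertex\<close>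

text \<open>The graphs share only part of their strands, and one passage through the changed region
  can take different numbers of steps in the two, so a step-by-step comparison fails. Comparing at
  common strands suffices because trips are deterministic: a strand has at most one continuation,
  and one that ends at the boundary has none. Hence the number of steps left on a completed trip of
  one graph is a measure that falls at each common strand, and arrival in the other graph follows by
  induction. The other obstacle is arithmetic modulo \<open>r\<close> around vertices whose cyclic
  orders have no natural start. A base arc is chosen at each affected vertex, positions become
  natural numbers with period \<open>r\<close>, and a turn is an addition. In the graph before the
  move the base is chosen so that the strands to be removed form an initial segment; the surviving
  ones then have the same or uniformly shifted numbers after the move. The bounds
  \<open>0 < i < r\<close> put every turn strictly between 0 and \<open>r\<close>, so a turn from a
  position below \<open>r\<close> wraps around at most once and all cases become linear
  arithmetic.\<close>

definition strand_pos :: "('v, 'a) hourglass_graph \<Rightarrow> 'a \<Rightarrow> nat \<Rightarrow> 'a \<times> nat" where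
  "strand_pos G a n = (cw_strand G ^^ n) (a, 0)"

definition turn :: "('v, 'a) hourglass_graph \<Rightarrow> nat \<Rightarrow> nat \<Rightarrow> 'v \<Rightarrow> nat" where
  "turn G r i v = (if white G v then i else r - i)"

definition next_strand ::
    "('v, 'a) hourglass_graph \<Rightarrow> nat \<Rightarrow> nat \<Rightarrow> 'a \<times> nat \<Rightarrow> 'a \<times> nat" where
  "next_strand G r i s = (cw_strand G ^^ turn G r i (head G (fst s))) (rev_strand G s)"

lemma cw_strand_strand_pos: "cw_strand G (strand_pos G a n) = strand_pos G a (Suc n)"
  by (simp add: strand_pos_def)

lemma cw_strand_funpow_strand_pos:
  "(cw_strand G ^^ k) (strand_pos G a n) = strand_pos G a (n + k)"
  by (simp add: strand_pos_def funpow_add add.commute[of n k])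

lemma strand_pos_first: "n < mult G a \<Longrightarrow> strand_pos G a n = (a, n)"
  by (induction n) (simp_all add: strand_pos_def cw_strand_def)

text \<open>Skipping all strands of the base arc moves the base to the next arc. This is how
  numberings with different base arcs are related.\<close>

lemma strand_pos_mult_add:
  assumes "mult G a > 0"
  shows "strand_pos G a (mult G a + n) = strand_pos G (cw G a) n"
proof -
  obtain k where k: "mult G a = Suc k" using assms by (metis Suc_pred)
  have "strand_pos G a (Suc k) = cw_strand G (strand_pos G a k)"
    by (simp add: strand_pos_def)
  also have "\<dots> = (cw G a, 0)" using k by (simp add: strand_pos_first cw_strand_def)
  finally have "strand_pos G a (mult G a) = (cw G a, 0)" using k by simp
  then show ?thesis
    using cw_strand_funpow_strand_pos[of n G a "mult G a"] by (simp add: strand_pos_def)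
qed

context hourglass_plabic_graph
begin

lemma arev_in [simp]: "a \<in> arcs G \<Longrightarrow> arev G a \<in> arcs G"
  using arev_in_arcs[of a] by (simp add: pre_digraph.truncate_def)

lemma tail_arev_eq [simp]: "a \<in> arcs G \<Longrightarrow> tail G (arev G a) = head G a"
  using tail_arev[of a] by (simp add: pre_digraph.truncate_def)

lemma head_arev_eq [simp]: "a \<in> arcs G \<Longrightarrow> head G (arev G a) = tail G a"
  using head_arev by (simp add: pre_digraph.truncate_def)

lemma tail_in [simp]: "a \<in> arcs G \<Longrightarrow> tail G a \<in> verts G"
  using tail_in_verts[of a] by (simp add: pre_digraph.truncate_def)

lemma head_in [simp]: "a \<in> arcs G \<Longrightarrow> head G a \<in> verts G"
  using head_in_verts[of a] by (simp add: pre_digraph.truncate_def)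

lemma finite_arcs_at: "finite (arcs_at G v)"
  using finite_arcs by (simp add: arcs_at_def pre_digraph.truncate_def)

lemma cw_in: "a \<in> arcs G \<Longrightarrow> cw G a \<in> arcs G"
  using permutes_in_image[OF cw_permutes] by blast

lemma tail_cw: assumes "a \<in> arcs G" shows "tail G (cw G a) = tail G a"
proof -
  have a: "a \<in> arcs_at G (tail G a)" using assms by (simp add: arcs_at_def)
  then have "cyclic_on (cw G) (arcs_at G (tail G a))"
    using assms by (intro cw_cyclic) auto
  from cyclic_on_inI[OF this a] show ?thesis by (simp add: arcs_at_def)
qed

lemma head_neq_tail: "a \<in> arcs G \<Longrightarrow> head G a \<noteq> tail G a"
  using bipartite by metis

lemma cw_strand_in:
  assumes "s \<in> strands G"
  shows "cw_strand G s \<in> strands G \<and> tail G (fst (cw_strand G s)) = tail G (fst s)"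
  using assms by (auto simp: cw_strand_def strands_def cw_in tail_cw mult_pos split: prod.splits)

lemma cw_strand_funpow_in:
  assumes "s \<in> strands G"
  shows "(cw_strand G ^^ n) s \<in> strands G \<and> tail G (fst ((cw_strand G ^^ n) s)) = tail G (fst s)"
  using assms by (induction n) (auto simp: cw_strand_in)

lemma rev_strand_in:
  assumes "s \<in> strands G"
  shows "rev_strand G s \<in> strands G" "tail G (fst (rev_strand G s)) = head G (fst s)"
  using assms by (auto simp: rev_strand_def strands_def mult_arev split: prod.splits)

lemma strand_pos_in:
  assumes "a \<in> arcs G"
  shows "strand_pos G a n \<in> strands G" "tail G (fst (strand_pos G a n)) = tail G a"
  using cw_strand_funpow_in[of "(a, 0)" n] assms
  by (auto simp: strand_pos_def strands_def mult_pos)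

lemma strand_pos_sum:
  assumes "a \<in> arcs G"
  shows "strand_pos G a ((\<Sum>l<n. mult G ((cw G ^^ l) a)) + k) = strand_pos G ((cw G ^^ n) a) k"
proof (induction n arbitrary: k)
  case (Suc n)
  have "(cw G ^^ n) a \<in> arcs G" using assms by (induction n) (auto simp: cw_in)
  then show ?case using Suc by (simp add: strand_pos_mult_add mult_pos add.assoc)
qed simp

context
  fixes a
  assumes a: "a \<in> arcs G" and internal: "tail G a \<notin> boundary G"
begin

text \<open>\<open>cw\<close> permutes the arcs at a vertex in one cycle, so the iterates of
  \<open>a\<close> before its first return meet each arc once.\<close>

lemma arcs_at_enum:
  obtains L where "(cw G ^^ L) a = a" "bij_betw (\<lambda>l. (cw G ^^ l) a) {..<L} (arcs_at G (tail G a))"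
proof -
  let ?L = "funpow_dist1 (cw G) a a"
  have a': "a \<in> arcs_at G (tail G a)" using a by (simp add: arcs_at_def)
  then have c: "cyclic_on (cw G) (arcs_at G (tail G a))" using a by (intro cw_cyclic) auto
  then have o: "orbit (cw G) a = arcs_at G (tail G a)" using a' by (rule orbit_cyclic_eq3)
  then have self: "a \<in> orbit (cw G) a" using a' by simp
  have "(cw G ^^ ?L) a = a" using self by (rule funpow_dist1_prop)
  moreover have "bij_betw (\<lambda>l. (cw G ^^ l) a) {..<?L} (arcs_at G (tail G a))"
    using inj_on_funpow_dist1[OF self] orbit_conv_funpow_dist1[OF self] o
    by (simp add: bij_betw_def atLeast0LessThan)
  ultimately show ?thesis by (rule that)
qed

text \<open>One revolution passes every arc at the vertex, and their multiplicities add up to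
  \<open>r\<close> by the degree condition. Both facts are read off from this one
  enumeration.\<close>

lemma strand_pos_period: "strand_pos G a (n + r) = strand_pos G a n"
  and strand_pos_surj:
    "s \<in> strands G \<Longrightarrow> tail G (fst s) = tail G a \<Longrightarrow> \<exists>n<r. s = strand_pos G a n"
proof -
  obtain L where L: "(cw G ^^ L) a = a"
      "bij_betw (\<lambda>l. (cw G ^^ l) a) {..<L} (arcs_at G (tail G a))"
    by (rule arcs_at_enum)
  have sum: "(\<Sum>l<L. mult G ((cw G ^^ l) a)) = r"
    using sum.reindex_bij_betw[OF L(2), of "mult G"] internal_degree[of "tail G a"] a internal
    by simp
  show "strand_pos G a (n + r) = strand_pos G a n"
    using strand_pos_sum[OF a, of L n] sum L(1) by (simp add: add.commute)
  assume s: "s \<in> strands G" "tail G (fst s) = tail G a"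
  then have "fst s \<in> arcs_at G (tail G a)" by (auto simp: strands_def arcs_at_def)
  then obtain l where l: "l < L" "fst s = (cw G ^^ l) a"
    using L(2) unfolding bij_betw_def by (metis (mono_tags, lifting) imageE lessThan_iff)
  \<comment> \<open>The bound \<open>l\<close> of the sum shadows the arc index that is its upper
    limit: \<open>n\<close> counts the strands of all arcs before \<open>fst s\<close>, plus the
    index of \<open>s\<close> within its arc.\<close>
  define n where "n = (\<Sum>l<l. mult G ((cw G ^^ l) a)) + snd s"
  have "snd s < mult G (fst s)" using s by (auto simp: strands_def)
  then have "s = strand_pos G a n"
    using strand_pos_sum[OF a, of l "snd s"] l by (simp add: n_def strand_pos_first prod_eq_iff)
  moreover have "n < r"
  proof -
    have "n < (\<Sum>l<Suc l. mult G ((cw G ^^ l) a))"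
      using \<open>snd s < mult G (fst s)\<close> l by (simp add: n_def)
    also have "\<dots> \<le> (\<Sum>l<L. mult G ((cw G ^^ l) a))"
      using l by (intro sum_mono2) auto
    finally show ?thesis using sum by simp
  qed
  ultimately show "\<exists>n<r. s = strand_pos G a n" by blast
qed

text \<open>Counting: \<open>r\<close> positions cover the \<open>r\<close> strands at the vertex,
  so none is covered twice.\<close>

lemma strand_pos_inj: "inj_on (strand_pos G a) {..<r}"
proof -
  let ?S = "Sigma (arcs_at G (tail G a)) (\<lambda>a. {..<mult G a})"
  have "card ?S = r" "finite ?S"
    using internal_degree[of "tail G a"] a internal finite_arcs_at by simp_all
  moreover have "?S \<subseteq> strand_pos G a ` {..<r}"
    using strand_pos_surj by (fastforce simp: arcs_at_def strands_def)
  then have "card ?S \<le> card (strand_pos G a ` {..<r})" by (intro card_mono) auto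
  ultimately show ?thesis
    using card_image_le[of "{..<r}" "strand_pos G a"] by (intro eq_card_imp_inj_on) auto
qed

end

lemma cw_strand_period:
  assumes "s \<in> strands G" "tail G (fst s) \<notin> boundary G"
  shows "(cw_strand G ^^ r) s = s"
proof -
  have a: "fst s \<in> arcs G" using assms by (auto simp: strands_def)
  then obtain n where "s = strand_pos G (fst s) n" using strand_pos_surj assms by metis
  then show ?thesis
    using strand_pos_period[OF a assms(2), of n] by (metis cw_strand_funpow_strand_pos)
qed

lemma next_strand_in:
  assumes "s \<in> strands G"
  shows "next_strand G r i s \<in> strands G" "tail G (fst (next_strand G r i s)) = head G (fst s)"
  unfolding next_strand_def using cw_strand_funpow_in[OF rev_strand_in(1)] rev_strand_in assms
  by auto

text \<open>
  An internal vertex has \<open>r\<close> strands, so \<open>i\<close> places counterclockwise are \<open>r - i\<close> places clockwise.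
  This makes the two colors interchangeable: a color swap amounts to replacing \<open>i\<close> by \<open>r - i\<close>.
\<close>

lemma trip_step_iff:
  assumes "i \<le> r"
  shows "trip_step G i s t \<longleftrightarrow>
    s \<in> strands G \<and> head G (fst s) \<notin> boundary G \<and> t = next_strand G r i s"
proof (cases "s \<in> strands G \<and> head G (fst s) \<notin> boundary G")
  case True
  note rev = rev_strand_in[of s]
  show ?thesis
  proof (cases "white G (head G (fst s))")
    case True
    then show ?thesis
      using \<open>s \<in> strands G \<and> _\<close> next_strand_in[of s i]
      by (auto simp: trip_step_def next_strand_def turn_def)
  next
    case False
    have "t = (cw_strand G ^^ (r - i)) (rev_strand G s)"
      if "t \<in> strands G" "(cw_strand G ^^ i) t = rev_strand G s"
    proof -
      have "tail G (fst t) = head G (fst s)"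
        using cw_strand_funpow_in[of t i] that rev True by simp
      \<comment> \<open>A full revolution is the identity at an internal vertex; splitting it into
        \<open>i\<close> places followed by \<open>r - i\<close> undoes the \<open>i\<close>
        places.\<close>
      then have "(cw_strand G ^^ r) t = t" using that True by (intro cw_strand_period) auto
      then have "(cw_strand G ^^ (r - i + i)) t = t" using assms by simp
      then show ?thesis using that by (simp add: funpow_add)
    qed
    moreover have "(cw_strand G ^^ i) ((cw_strand G ^^ (r - i)) (rev_strand G s)) = rev_strand G s"
    proof -
      have "(cw_strand G ^^ (i + (r - i))) (rev_strand G s) = rev_strand G s"
        using cw_strand_period[of "rev_strand G s"] rev True assms by simp
      then show ?thesis by (simp add: funpow_add)
    qed
    ultimately show ?thesis
      using True False next_strand_in[of s i]
      by (auto simp: trip_step_def next_strand_def turn_def)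
  qed
qed (auto simp: trip_step_def)

lemma trip_step_unique:
  assumes "i \<le> r" "trip_step G i s t" "trip_step G i s t'"
  shows "t = t'"
  using assms by (simp add: trip_step_iff)

end

section \<open>Comparing trips in two graphs\<close>

text \<open>A deterministic run to a terminal point is unique, so any \<open>y\<close> reached from
  \<open>x\<close> by at least one step lies on it, strictly nearer to \<open>f\<close>. This is the
  descent used for trips.\<close>

lemma tranclp_rtranclp_relpowp:
  assumes det: "\<And>x y z. R x y \<Longrightarrow> R x z \<Longrightarrow> y = z"
    and "R\<^sup>+\<^sup>+ x y" and "(R ^^ n) x f" and stop: "\<And>z. \<not> R f z"
  shows "\<exists>m<n. (R ^^ m) y f"
  using assms(2,3)
proof (induction arbitrary: n rule: converse_tranclp_induct)
  case (base x)
  show ?case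
  proof (cases n)
    case 0
    then show ?thesis using base stop by auto
  next
    case (Suc m)
    then obtain z where "R x z" "(R ^^ m) z f" using base by (metis relpowp_Suc_D2)
    then show ?thesis using det base Suc by blast
  qed
next
  case (step x z)
  show ?case
  proof (cases n)
    case 0
    then show ?thesis using step stop by auto
  next
    case (Suc m)
    then obtain z' where "R x z'" "(R ^^ m) z' f" using step by (metis relpowp_Suc_D2)
    then have "\<exists>k<m. (R ^^ k) y f" using det step by blast
    then show ?thesis using Suc less_SucI by blast
  qed
qed

text \<open>Induction on the number of \<open>R\<close>-steps left: each passage from one point of
  \<open>A\<close> to another shortens the \<open>R\<close>-run and adds a piece to the
  \<open>S\<close>-run. The point \<open>z\<close> may be any later common point of the two runs,
  not just the first.\<close>

lemma rtranclp_first_return: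
  assumes det: "\<And>x y z. R x y \<Longrightarrow> R x z \<Longrightarrow> y = z"
    and return: "\<And>x y. x \<in> A \<Longrightarrow> R x y \<Longrightarrow> \<exists>z\<in>A. R\<^sup>+\<^sup>+ x z \<and> S\<^sup>+\<^sup>+ x z"
    and "x \<in> A" and "R\<^sup>*\<^sup>* x f" and stop: "\<And>z. \<not> R f z"
  shows "S\<^sup>*\<^sup>* x f"
proof -
  obtain n where "(R ^^ n) x f" using assms(4) by (auto simp: rtranclp_power)
  then show ?thesis using \<open>x \<in> A\<close>
  proof (induction n arbitrary: x rule: less_induct)
    case (less n)
    show ?case
    proof (cases n)
      case 0
      then show ?thesis using less by simp
    next
      case (Suc m)
      then obtain y where "R x y" using less by (metis relpowp_Suc_D2)
      then obtain z where z: "z \<in> A" "R\<^sup>+\<^sup>+ x z" "S\<^sup>+\<^sup>+ x z" using return less by blast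
      obtain m where "m < n" "(R ^^ m) z f"
        using tranclp_rtranclp_relpowp[of R x z n f] det z(2) less.prems(1) stop by metis
      then have "S\<^sup>*\<^sup>* z f" using less z by blast
      then show ?thesis using z by (meson rtranclp_trans tranclp_into_rtranclp)
    qed
  qed
qed

text \<open>Trips start and end on arcs that touch the boundary, and \<open>bd\<close> puts these in
  \<open>A\<close>; so a trip splits into passages between strands over \<open>A\<close>. That no
  step leaves a strand heading to the boundary is the stopping condition.\<close>

lemma strand_trip_subset_by_return:
  assumes "hourglass_plabic_graph r G" "i \<le> r" and "bnum G' = bnum G"
    and agree: "\<And>a. a \<in> A \<Longrightarrow> a \<in> arcs G' \<and> mult G' a = mult G a"
    and ends: "\<And>a j. a \<in> A \<Longrightarrow> j \<in> {1..bnum G} \<Longrightarrow>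
        (tail G' a = bvert G' j \<longleftrightarrow> tail G a = bvert G j) \<and>
        (head G' a = bvert G' j \<longleftrightarrow> head G a = bvert G j)"
    and bd: "\<And>a. a \<in> arcs G \<Longrightarrow> tail G a \<in> boundary G \<or> head G a \<in> boundary G \<Longrightarrow> a \<in> A"
    and return: "\<And>s. s \<in> strands G \<Longrightarrow> fst s \<in> A \<Longrightarrow> head G (fst s) \<notin> boundary G \<Longrightarrow>
        \<exists>t\<in>strands G. fst t \<in> A \<and> (trip_step G i)\<^sup>+\<^sup>+ s t \<and> (trip_step G' i)\<^sup>+\<^sup>+ s t"
  shows "strand_trip G i \<subseteq> strand_trip G' i"
proof
  fix x assume "x \<in> strand_trip G i"
  then obtain j p k q a c where x: "x = ((j, p), (k, q))"
    and jk: "j \<in> {1..bnum G}" "k \<in> {1..bnum G}"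
    and a: "(a, p) \<in> strands G" "tail G a = bvert G j"
    and t: "(trip_step G i)\<^sup>*\<^sup>* (a, p) (c, q)" and c: "head G c = bvert G k"
    by (auto simp: strand_trip_def)
  have b: "tail G a \<in> boundary G" "head G c \<in> boundary G"
    using jk a c by (auto simp: boundary_def)
  have "(c, q) \<in> strands G" using t a by (induction rule: rtranclp_induct) (auto simp: trip_step_def)
  then have A: "a \<in> A" "c \<in> A" using bd a b by (auto simp: strands_def)
  have "(trip_step G' i)\<^sup>*\<^sup>* (a, p) (c, q)"
  proof (rule rtranclp_first_return[OF _ _ _ t])
    show "y = z" if "trip_step G i x y" "trip_step G i x z" for x y z
      using hourglass_plabic_graph.trip_step_unique[OF assms(1,2)] that by blast
    show "\<exists>z\<in>{s \<in> strands G. fst s \<in> A}. (trip_step G i)\<^sup>+\<^sup>+ x z \<and> (trip_step G' i)\<^sup>+\<^sup>+ x z"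
      if "x \<in> {s \<in> strands G. fst s \<in> A}" "trip_step G i x y" for x y
    proof -
      have "x \<in> strands G" "fst x \<in> A" "head G (fst x) \<notin> boundary G"
        using that by (simp_all add: trip_step_def)
      then show ?thesis using return[of x] by blast
    qed
    show "(a, p) \<in> {s \<in> strands G. fst s \<in> A}" using A a by simp
    show "\<not> trip_step G i (c, q) z" for z using b by (simp add: trip_step_def)
  qed
  moreover have "(a, p) \<in> strands G'" "tail G' a = bvert G' j" "head G' c = bvert G' k"
    using a c agree[OF A(1)] ends[OF A(1) jk(1)] ends[OF A(2) jk(2)] by (auto simp: strands_def)
  ultimately show "x \<in> strand_trip G' i"
    using x jk \<open>bnum G' = bnum G\<close> by (auto simp: strand_trip_def)
qed

text \<open>The return condition is symmetric once the two graphs agree on strands over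
  \<open>A\<close> and on which of them end at the boundary. An analysis of passages starting from
  \<open>G\<close> thus serves both inclusions.\<close>

lemma strand_trip_eq_by_return:
  assumes "hourglass_plabic_graph r G" "hourglass_plabic_graph r G'" "i \<le> r"
    and bnum: "bnum G' = bnum G"
    and agree: "\<And>a. a \<in> A \<Longrightarrow> a \<in> arcs G \<and> a \<in> arcs G' \<and> mult G' a = mult G a"
    and ends: "\<And>a j. a \<in> A \<Longrightarrow> j \<in> {1..bnum G} \<Longrightarrow>
        (tail G' a = bvert G' j \<longleftrightarrow> tail G a = bvert G j) \<and>
        (head G' a = bvert G' j \<longleftrightarrow> head G a = bvert G j)"
    and bd: "\<And>a. a \<in> arcs G \<Longrightarrow> tail G a \<in> boundary G \<or> head G a \<in> boundary G \<Longrightarrow> a \<in> A"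
    and bd': "\<And>a. a \<in> arcs G' \<Longrightarrow> tail G' a \<in> boundary G' \<or> head G' a \<in> boundary G' \<Longrightarrow> a \<in> A"
    and return: "\<And>s. s \<in> strands G \<Longrightarrow> fst s \<in> A \<Longrightarrow> head G (fst s) \<notin> boundary G \<Longrightarrow>
        \<exists>t\<in>strands G. fst t \<in> A \<and> (trip_step G i)\<^sup>+\<^sup>+ s t \<and> (trip_step G' i)\<^sup>+\<^sup>+ s t"
  shows "strand_trip G i = strand_trip G' i"
proof
  show "strand_trip G i \<subseteq> strand_trip G' i"
    by (rule strand_trip_subset_by_return[OF assms(1,3) bnum _ ends bd return]) (simp_all add: agree)
  have st: "s \<in> strands G' \<longleftrightarrow> s \<in> strands G" if "fst s \<in> A" for s
    using that agree by (auto simp: strands_def)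
  have hd: "head G' a \<in> boundary G' \<longleftrightarrow> head G a \<in> boundary G" if "a \<in> A" for a
    using ends[OF that] bnum by (simp add: boundary_def image_iff)
  show "strand_trip G' i \<subseteq> strand_trip G i"
  proof (rule strand_trip_subset_by_return[OF assms(2,3) bnum[symmetric] _ _ bd'])
    show "a \<in> arcs G \<and> mult G a = mult G' a" if "a \<in> A" for a
      using agree[OF that] by simp
    show "(tail G a = bvert G j \<longleftrightarrow> tail G' a = bvert G' j) \<and>
        (head G a = bvert G j \<longleftrightarrow> head G' a = bvert G' j)" if "a \<in> A" "j \<in> {1..bnum G'}" for a j
      using ends[of a j] that bnum by metis
    show "\<exists>t\<in>strands G'. fst t \<in> A \<and> (trip_step G' i)\<^sup>+\<^sup>+ s t \<and> (trip_step G i)\<^sup>+\<^sup>+ s t"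
      if "s \<in> strands G'" "fst s \<in> A" "head G' (fst s) \<notin> boundary G'" for s
      using return[of s] that st hd by blast
  qed
qed

context hourglass_plabic_graph
begin

lemma trip_step_next:
  assumes "s \<in> strands G" "head G (fst s) \<notin> boundary G" "i \<le> r"
  shows "trip_step G i s (next_strand G r i s)"
  using assms by (simp add: trip_step_iff)

text \<open>In coordinates around an internal vertex a trip adds the turn to the position of
  arrival. All trips in the changed regions are computed in this form.\<close>

lemma trip_step_strand_pos:
  assumes "s \<in> strands G" "rev_strand G s = strand_pos G a n" "a \<in> arcs G"
    and "tail G a \<notin> boundary G" "i \<le> r"
  shows "trip_step G i s (strand_pos G a (n + turn G r i (tail G a)))"
proof -
  have "head G (fst s) = tail G a"
    using rev_strand_in(2)[OF assms(1)] strand_pos_in(2)[OF assms(3)] assms(2) by metis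
  then show ?thesis
    using trip_step_next[of s i] assms
    by (simp add: next_strand_def cw_strand_funpow_strand_pos)
qed

end

section \<open>Invariance under isomorphism of rotation systems\<close>

text \<open>\<open>strand_trip\<close> records only boundary labels and strand indices, no names of
  vertices or arcs. The arc bijection, with strand indices kept, commutes with
  \<open>next_strand\<close>, so the two relations are equal.\<close>

lemma strand_trip_iso_eq:
  assumes "hourglass_plabic_graph r G" "hourglass_plabic_graph r H" "hourglass_iso G H" "i \<le> r"
  shows "strand_trip G i = strand_trip H i"
proof -
  interpret G: hourglass_plabic_graph r G by fact
  interpret H: hourglass_plabic_graph r H by fact
  obtain f g where f: "bij_betw f (verts G) (verts H)" and g: "bij_betw g (arcs G) (arcs H)"
    and fg: "\<And>d. d \<in> arcs G \<Longrightarrow> tail H (g d) = f (tail G d) \<and> head H (g d) = f (head G d) \<and>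
           arev H (g d) = g (arev G d) \<and> cw H (g d) = g (cw G d) \<and> mult H (g d) = mult G d"
    and white: "\<And>v. v \<in> verts G \<Longrightarrow> white H (f v) = white G v"
    and bnum: "bnum H = bnum G" and bv: "\<And>j. j \<in> {1..bnum G} \<Longrightarrow> bvert H j = f (bvert G j)"
    using assms(3) unfolding hourglass_iso_def by blast
  define \<phi> where "\<phi> = (\<lambda>s :: 'b \<times> nat. (g (fst s), snd s))"
  have g_in: "g a \<in> arcs H" if "a \<in> arcs G" for a
    using that g by (auto simp: bij_betw_def)
  have f_eq: "f v = f w \<longleftrightarrow> v = w" if "v \<in> verts G" "w \<in> verts G" for v w
    using that f by (auto simp: bij_betw_def inj_on_def)
  have \<phi>_in: "\<phi> s \<in> strands H" if "s \<in> strands G" for s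
    using that g_in fg by (auto simp: \<phi>_def strands_def)
  have bvert_iff: "f v = bvert H j \<longleftrightarrow> v = bvert G j" if "v \<in> verts G" "j \<in> {1..bnum G}" for v j
    using that f_eq G.bvert_in_verts bv by metis
  have boundary_iff: "f v \<in> boundary H \<longleftrightarrow> v \<in> boundary G" if "v \<in> verts G" for v
    using that bnum bvert_iff by (auto simp: boundary_def image_iff)
  have cw: "(cw_strand H ^^ n) (\<phi> s) = \<phi> ((cw_strand G ^^ n) s)" if "s \<in> strands G" for s n
  proof (induction n)
    case (Suc n)
    have "(cw_strand G ^^ n) s \<in> strands G" using G.cw_strand_funpow_in that by blast
    then show ?case using Suc fg by (auto simp: cw_strand_def \<phi>_def strands_def split: prod.splits)
  qed simp
  have next_eq: "next_strand H r i (\<phi> s) = \<phi> (next_strand G r i s)" if s: "s \<in> strands G" for s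
  proof -
    have a: "fst s \<in> arcs G" using s by (auto simp: strands_def)
    have "rev_strand H (\<phi> s) = \<phi> (rev_strand G s)"
      using fg[OF a] by (simp add: rev_strand_def \<phi>_def split: prod.splits)
    moreover have "turn H r i (head H (fst (\<phi> s))) = turn G r i (head G (fst s))"
      using fg[OF a] white G.head_in[OF a] by (simp add: turn_def \<phi>_def)
    ultimately show ?thesis
      using cw G.rev_strand_in(1)[OF s] by (simp add: next_strand_def)
  qed
  \<comment> \<open>The existential form says that a step from an image strand stays in the image,
    so paths in \<open>H\<close> lift to \<open>G\<close> without an inverse of
    \<open>\<phi>\<close>.\<close>
  have step: "trip_step H i (\<phi> s) t' \<longleftrightarrow> (\<exists>t. t' = \<phi> t \<and> trip_step G i s t)"
    if s: "s \<in> strands G" for s t'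
  proof -
    have a: "fst s \<in> arcs G" using s by (auto simp: strands_def)
    have "head H (fst (\<phi> s)) \<in> boundary H \<longleftrightarrow> head G (fst s) \<in> boundary G"
      using fg[OF a] boundary_iff G.head_in[OF a] by (simp add: \<phi>_def)
    then show ?thesis
      using next_eq[OF s] s \<phi>_in[OF s] assms(4) by (auto simp: G.trip_step_iff H.trip_step_iff simp del: split_paired_Ex)
  qed
  have path_in: "t \<in> strands G" if "(trip_step G i)\<^sup>*\<^sup>* s t" "s \<in> strands G" for s t
    using that by (induction rule: rtranclp_induct) (auto simp: trip_step_def)
  have path: "(trip_step H i)\<^sup>*\<^sup>* (\<phi> s) t' \<longleftrightarrow> (\<exists>t. t' = \<phi> t \<and> (trip_step G i)\<^sup>*\<^sup>* s t)" (is "?L \<longleftrightarrow> ?R")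
    if s: "s \<in> strands G" for s t'
  proof
    show ?R if ?L
      using that
    proof (induction rule: rtranclp_induct)
      case base
      show ?case by blast
    next
      case (step t' t'')
      then obtain t where "t' = \<phi> t" "(trip_step G i)\<^sup>*\<^sup>* s t" by blast
      then show ?case using step(2) \<open>\<And>t' s. s \<in> strands G \<Longrightarrow> trip_step H i (\<phi> s) t' \<longleftrightarrow> _\<close> path_in[OF _ s]
        by (metis rtranclp.rtrancl_into_rtrancl)
    qed
    have "(trip_step H i)\<^sup>*\<^sup>* (\<phi> s) (\<phi> t)" if "(trip_step G i)\<^sup>*\<^sup>* s t" for t
      using that
    proof (induction rule: rtranclp_induct)
      case (step t u)
      then show ?case using \<open>\<And>t' s. s \<in> strands G \<Longrightarrow> trip_step H i (\<phi> s) t' \<longleftrightarrow> _\<close> path_in[OF _ s]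
        by (metis rtranclp.rtrancl_into_rtrancl)
    qed auto
    then show ?L if ?R using that by blast
  qed
  have "((j, p), (k, q)) \<in> strand_trip G i \<longleftrightarrow> ((j, p), (k, q)) \<in> strand_trip H i" (is "?L \<longleftrightarrow> ?R")
    for j p k q
  proof
    assume ?L
    then obtain a c where jk: "j \<in> {1..bnum G}" "k \<in> {1..bnum G}"
      and a: "(a, p) \<in> strands G" "tail G a = bvert G j"
      and t: "(trip_step G i)\<^sup>*\<^sup>* (a, p) (c, q)" and c: "head G c = bvert G k"
      by (auto simp: strand_trip_def)
    have "(c, q) \<in> strands G" using path_in t a by blast
    then have ac: "a \<in> arcs G" "c \<in> arcs G" using a by (auto simp: strands_def)
    have "(trip_step H i)\<^sup>*\<^sup>* (g a, p) (g c, q)" "(g a, p) \<in> strands H"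
      using path[OF a(1)] t \<phi>_in[OF a(1)] by (auto simp: \<phi>_def)
    moreover have "tail H (g a) = bvert H j" "head H (g c) = bvert H k"
      using ac fg a c bv jk by auto
    ultimately show ?R using jk bnum by (auto simp: strand_trip_def)
  next
    assume ?R
    then obtain a' c' where jk: "j \<in> {1..bnum G}" "k \<in> {1..bnum G}"
      and a': "(a', p) \<in> strands H" "tail H a' = bvert H j"
      and t: "(trip_step H i)\<^sup>*\<^sup>* (a', p) (c', q)" and c': "head H c' = bvert H k"
      using bnum by (auto simp: strand_trip_def)
    obtain a where a: "a \<in> arcs G" "a' = g a"
      using a' g by (auto simp: strands_def bij_betw_def)
    then have s: "(a, p) \<in> strands G" "\<phi> (a, p) = (a', p)"
      using a' fg by (auto simp: strands_def \<phi>_def)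
    obtain c where c: "(trip_step G i)\<^sup>*\<^sup>* (a, p) (c, q)" "c' = g c"
      using path[OF s(1)] t s(2) by (auto simp: \<phi>_def)
    have "c \<in> arcs G" using path_in c s by (fastforce simp: strands_def)
    then have "tail G a = bvert G j" "head G c = bvert G k"
      using a c a' c' fg bvert_iff jk by auto
    then show ?L using jk s c by (auto simp: strand_trip_def)
  qed
  then show ?thesis by auto
qed

section \<open>Arcs left in place by a move\<close>

text \<open>
  \<open>D\<close> consists of the arcs that a move from \<open>G\<close> to \<open>G'\<close> leaves in place, up to the names of their ends.
\<close>

locale common_part =
  G: hourglass_plabic_graph r G + G': hourglass_plabic_graph r G'
  for r :: nat and G :: "('v, 'a) hourglass_graph" and G' :: "('v, 'a) hourglass_graph" +
  fixes D :: "'a set" and i :: nat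
  assumes i_pos: "0 < i" and i_less: "i < r"
    and D_in: "a \<in> D \<Longrightarrow> a \<in> arcs G" and D_in': "a \<in> D \<Longrightarrow> a \<in> arcs G'"
    and arev_D: "a \<in> D \<Longrightarrow> arev G a \<in> D"
    and arev_same: "a \<in> D \<Longrightarrow> arev G' a = arev G a"
    and mult_same: "a \<in> D \<Longrightarrow> mult G' a = mult G a"
    and cw_same: "a \<in> D \<Longrightarrow> cw G a \<in> D \<Longrightarrow> cw G' a = cw G a"
    and white_same: "a \<in> D \<Longrightarrow> white G' (head G' a) = white G (head G a)"
    and bnum_same: "bnum G' = bnum G"
    and ends_same: "a \<in> D \<Longrightarrow> j \<in> {1..bnum G} \<Longrightarrow> head G' a = bvert G' j \<longleftrightarrow> head G a = bvert G j"
    and old_internal: "a \<in> arcs G \<Longrightarrow> a \<notin> D \<Longrightarrow> head G a \<notin> boundary G \<and> tail G a \<notin> boundary G"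
    and new_internal: "a \<in> arcs G' \<Longrightarrow> a \<notin> D \<Longrightarrow> head G' a \<notin> boundary G' \<and> tail G' a \<notin> boundary G'"
begin

lemma boundary_same: "a \<in> D \<Longrightarrow> head G' a \<in> boundary G' \<longleftrightarrow> head G a \<in> boundary G"
  using ends_same[of a] bnum_same unfolding boundary_def image_iff by metis

lemma strands_same: "fst s \<in> D \<Longrightarrow> s \<in> strands G' \<longleftrightarrow> s \<in> strands G"
  using D_in D_in' mult_same by (auto simp: strands_def)

lemma rev_strand_same: "fst s \<in> D \<Longrightarrow> rev_strand G' s = rev_strand G s"
  by (cases s) (simp add: rev_strand_def arev_same)

lemma cw_strand_same:
  assumes "fst s \<in> D" "fst (cw_strand G s) \<in> D"
  shows "cw_strand G' s = cw_strand G s"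
  using assms by (auto simp: cw_strand_def mult_same cw_same split: prod.splits if_splits)

text \<open>The two numberings may have different base arcs and offsets; once they meet at a strand
  they advance together for as long as the walk in \<open>G\<close> stays on arcs of
  \<open>D\<close>.\<close>

lemma strand_pos_same:
  assumes "strand_pos G' a' l = strand_pos G a k"
    and "\<And>m. m \<le> n \<Longrightarrow> fst (strand_pos G a (k + m)) \<in> D"
  shows "strand_pos G' a' (l + n) = strand_pos G a (k + n)"
  using assms
proof (induction n)
  case (Suc n)
  then have "strand_pos G' a' (l + n) = strand_pos G a (k + n)" by simp
  moreover have "cw_strand G' (strand_pos G a (k + n)) = cw_strand G (strand_pos G a (k + n))"
    using Suc.prems(2)[of n] Suc.prems(2)[of "Suc n"]
    by (intro cw_strand_same) (simp_all add: cw_strand_strand_pos)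
  ultimately show ?case by (simp flip: cw_strand_strand_pos)
qed simp

text \<open>The arcs of \<open>E\<close> use up their strands at positions below \<open>k\<close>.
  Positions below \<open>r\<close> are distinct, so from \<open>k\<close> on only arcs of
  \<open>D\<close> remain.\<close>

lemma strand_pos_in_D:
  assumes "a \<in> arcs G" "tail G a \<notin> boundary G" "n < r"
    and "arcs_at G (tail G a) - D \<subseteq> E"
    and "\<And>d p. d \<in> E \<Longrightarrow> p < mult G d \<Longrightarrow> \<exists>m<k. (d, p) = strand_pos G a m" and "k \<le> n"
  shows "fst (strand_pos G a n) \<in> D"
proof (rule ccontr)
  obtain d p where dp: "strand_pos G a n = (d, p)" by fastforce
  assume "fst (strand_pos G a n) \<notin> D"
  moreover have "d \<in> arcs_at G (tail G a)" "p < mult G d"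
    using G.strand_pos_in[OF assms(1), of n] dp by (auto simp: strands_def arcs_at_def)
  ultimately have "d \<in> E" "p < mult G d" using assms(4) dp by auto
  then obtain m where m: "m < k" "(d, p) = strand_pos G a m" using assms(5) by blast
  then have "strand_pos G a m = strand_pos G a n" using dp by simp
  then have "m = n"
    using inj_onD[OF G.strand_pos_inj[OF assms(1,2)], of m n] m assms(3,6) by simp
  then show False using m assms(6) by simp
qed

text \<open>Around a vertex with all its arcs in \<open>D\<close> the rotations of both graphs
  coincide, so one step in each graph already gives the common strand.\<close>

lemma trip_step_regular:
  assumes "s \<in> strands G" "fst s \<in> D" "head G (fst s) \<notin> boundary G"
    and regular: "arcs_at G (head G (fst s)) \<subseteq> D"
  shows "\<exists>t\<in>strands G. fst t \<in> D \<and> (trip_step G i)\<^sup>+\<^sup>+ s t \<and> (trip_step G' i)\<^sup>+\<^sup>+ s t"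
proof -
  let ?s = "rev_strand G s"
  have s: "?s \<in> strands G" "tail G (fst ?s) = head G (fst s)"
    using G.rev_strand_in assms by auto
  have D: "fst ((cw_strand G ^^ n) ?s) \<in> D" for n
    using G.cw_strand_funpow_in[OF s(1), of n] s(2) regular by (auto simp: arcs_at_def strands_def)
  have "(cw_strand G' ^^ n) ?s = (cw_strand G ^^ n) ?s" for n
  proof (induction n)
    case (Suc n)
    then show ?case using cw_strand_same[OF D[of n]] D[of "Suc n"] by simp
  qed simp
  then have "next_strand G' r i s = next_strand G r i s"
    using assms rev_strand_same white_same by (simp add: next_strand_def turn_def)
  moreover have "trip_step G i s (next_strand G r i s)"
    using G.trip_step_next assms i_less by simp
  moreover have "trip_step G' i s (next_strand G' r i s)"
    using G'.trip_step_next assms i_less strands_same boundary_same by simp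
  moreover have "next_strand G r i s \<in> strands G" "fst (next_strand G r i s) \<in> D"
    using G.next_strand_in(1) assms(1) D by (auto simp: next_strand_def)
  ultimately show ?thesis by (metis tranclp.r_into_trancl)
qed

lemma strand_trip_eq:
  assumes "\<And>s. s \<in> strands G \<Longrightarrow> fst s \<in> D \<Longrightarrow> head G (fst s) \<notin> boundary G \<Longrightarrow>
      \<not> arcs_at G (head G (fst s)) \<subseteq> D \<Longrightarrow>
      \<exists>t. fst t \<in> D \<and> (trip_step G i)\<^sup>+\<^sup>+ s t \<and> (trip_step G' i)\<^sup>+\<^sup>+ s t"
  shows "strand_trip G i = strand_trip G' i"
proof (rule strand_trip_eq_by_return[where r = r and A = D])
  show "a \<in> arcs G \<and> a \<in> arcs G' \<and> mult G' a = mult G a" if "a \<in> D" for a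
    using that D_in D_in' mult_same by simp
  show "(tail G' a = bvert G' j \<longleftrightarrow> tail G a = bvert G j) \<and>
        (head G' a = bvert G' j \<longleftrightarrow> head G a = bvert G j)" if "a \<in> D" "j \<in> {1..bnum G}" for a j
  proof -
    \<comment> \<open>The locale compares only heads with boundary vertices; a tail is the head of
      the reversed arc, which lies in \<open>D\<close> too.\<close>
    have "head G (arev G a) = tail G a" "head G' (arev G a) = tail G' a"
      using that D_in D_in' arev_same G.head_arev_eq G'.head_arev_eq by metis+
    then show ?thesis using ends_same[OF arev_D] ends_same that by metis
  qed
  show "\<exists>t\<in>strands G. fst t \<in> D \<and> (trip_step G i)\<^sup>+\<^sup>+ s t \<and> (trip_step G' i)\<^sup>+\<^sup>+ s t"
    if s: "s \<in> strands G" "fst s \<in> D" "head G (fst s) \<notin> boundary G" for s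
  proof (cases "arcs_at G (head G (fst s)) \<subseteq> D")
    case True
    then show ?thesis using trip_step_regular s by blast
  next
    case False
    then obtain t where t: "fst t \<in> D" "(trip_step G i)\<^sup>+\<^sup>+ s t" "(trip_step G' i)\<^sup>+\<^sup>+ s t"
      using assms[OF s] by blast
    from t(2) have "t \<in> strands G" by (induction rule: tranclp_induct) (auto simp: trip_step_def)
    then show ?thesis using t by blast
  qed
qed (use old_internal new_internal bnum_same i_less G.hourglass_plabic_graph_axioms
      G'.hourglass_plabic_graph_axioms in auto)

end

section \<open>Contraction moves\<close>

text \<open>A turn at \<open>u\<close> or \<open>u'\<close> can stop at a common strand of that
  vertex, possibly after passing over the whole contracted edge, or stop inside that edge. Only the
  second case needs the detour through \<open>z\<close>, and it ends on the other side at the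
  position that the single turn at the merged vertex reaches.\<close>

lemma strand_trip_contraction_eq:
  assumes "contraction_move r G G'" "0 < i" "i < r"
  shows "strand_trip G i = strand_trip G' i"
proof -
  obtain z x y where hg: "hourglass_plabic_graph r G" "hourglass_plabic_graph r G'"
    and z: "z \<in> verts G" "z \<notin> boundary G" "arcs_at G z = {x, y}" "x \<noteq> y"
    and u_neq: "head G x \<noteq> head G y" and ub: "head G x \<notin> boundary G" "head G y \<notin> boundary G"
    and verts': "verts G' = verts G - {z, head G y}"
    and arcs': "arcs G' = arcs G - {x, y, arev G x, arev G y}"
    and same: "\<forall>d\<in>arcs G - {x, y, arev G x, arev G y}.
             tail G' d = (if tail G d = head G y then head G x else tail G d) \<and>
             head G' d = (if head G d = head G y then head G x else head G d) \<and>
             arev G' d = arev G d \<and> mult G' d = mult G d \<and>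
             cw G' d = (if cw G d = arev G x then cw G (arev G y)
                        else if cw G d = arev G y then cw G (arev G x)
                        else cw G d)"
    and white': "\<forall>t\<in>verts G'. white G' t = white G t"
    and bnum': "bnum G' = bnum G" and bvert': "\<forall>j\<in>{1..bnum G}. bvert G' j = bvert G j"
    using assms(1) unfolding contraction_move_def Let_def by (elim conjE exE) (rule that; assumption)
  note same = bspec[OF same] and white' = bspec[OF white'] and bvert' = bspec[OF bvert']
  interpret G: hourglass_plabic_graph r G by fact
  interpret G': hourglass_plabic_graph r G' by fact
  define u where "u = head G x"
  define u' where "u' = head G y"
  define D where "D = arcs G - {x, y, arev G x, arev G y}"
  have xy: "x \<in> arcs G" "y \<in> arcs G" "tail G x = z" "tail G y = z"
    using z by (auto simp: arcs_at_def)
  have uv: "u \<noteq> u'" "u \<noteq> z" "u' \<noteq> z" "u \<notin> boundary G" "u' \<notin> boundary G"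
    using u_neq ub G.head_neq_tail[of x] G.head_neq_tail[of y] xy by (auto simp: u_def u'_def)
  have arevs: "arev G x \<in> arcs G" "arev G y \<in> arcs G" "tail G (arev G x) = u" "tail G (arev G y) = u'"
      "arev G (arev G x) = x" "arev G (arev G y) = y"
    using xy by (simp_all add: u_def u'_def)
  have D_notin: "d \<in> D \<Longrightarrow> arev G d \<in> D" for d
    unfolding D_def using arevs by (metis Diff_iff G.arev_arev G.arev_in insertCI insertE singletonD)
  have D_tail: "tail G d \<noteq> z" if "d \<in> D" for d
    using that z(3) by (auto simp: D_def arcs_at_def)
  have D_head: "head G d \<noteq> z" if "d \<in> D" for d
    using D_tail[OF D_notin[OF that]] that by (simp add: D_def)
  have white_u: "white G u = white G u'" "white G z \<noteq> white G u"
    using G.bipartite xy by (auto simp: u_def u'_def)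
  have cw_x: "cw G x = y" and cw_y: "cw G y = x"
  proof -
    have c: "cyclic_on (cw G) {x, y}" using G.cw_cyclic[of z] z by simp
    show "cw G x = y" "cw G y = x"
      \<comment> \<open>A cyclic permutation of a two-element set fixes neither element, so it swaps
        them.\<close>
      using eq_on_cyclic_on_iff1[OF c, of x] eq_on_cyclic_on_iff1[OF c, of y] z(4)
      by (auto simp: card_insert_if)
  qed
  let ?A = "mult G x" and ?B = "mult G y"
  have AB: "?A + ?B = r" using G.internal_degree[of z] z by simp
  have AB_pos: "0 < ?A" "0 < ?B" using xy G.mult_pos by auto
  have mult_arev: "mult G (arev G x) = ?A" "mult G (arev G y) = ?B" using xy G.mult_arev by auto
  have bvert_neq: "bvert G j \<noteq> u" "bvert G j \<noteq> u'" if "j \<in> {1..bnum G}" for j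
    using that uv by (auto simp: boundary_def)
  have boundary': "boundary G' = boundary G" using bnum' bvert' by (auto simp: boundary_def)
  interpret common_part r G G' D i
  proof
    show "white G' (head G' a) = white G (head G a)" if "a \<in> D" for a
    proof -
      have "head G' a \<in> verts G'" using that arcs' by (simp add: D_def)
      then show ?thesis using white' same[of a] that white_u by (auto simp: D_def u_def u'_def)
    qed
    show "head G' a = bvert G' j \<longleftrightarrow> head G a = bvert G j" if "a \<in> D" "j \<in> {1..bnum G}" for a j
    proof -
      have "head G' a = (if head G a = u' then u else head G a)"
        using same[of a] that by (simp add: D_def u_def u'_def)
      then show ?thesis
        using bvert'[OF that(2)] bvert_neq[OF that(2)] by auto
    qed
    show "head G a \<notin> boundary G \<and> tail G a \<notin> boundary G" if "a \<in> arcs G" "a \<notin> D" for a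
      using that uv z(2) xy by (auto simp: D_def u_def u'_def)
    show "arev G a \<in> D" if "a \<in> D" for a using that by (rule D_notin)
  qed (use assms same arcs' bnum' in \<open>auto simp: D_def\<close>)
  \<comment> \<open>\<open>?P\<close>, \<open>?Q\<close> and \<open>?M\<close> run around \<open>u\<close>, \<open>u'\<close> and the merged vertex: positions below \<open>?A\<close> of
    the latter come from \<open>u'\<close>, the others from \<open>u\<close>.\<close>
  let ?P = "strand_pos G (arev G x)" and ?Q = "strand_pos G (arev G y)"
  define e where "e = cw G (arev G y)"
  let ?M = "strand_pos G' e"
  have P_first: "?P n = (arev G x, n)" if "n < ?A" for n
    using that mult_arev by (simp add: strand_pos_first)
  have Q_first: "?Q n = (arev G y, n)" if "n < ?B" for n
    using that mult_arev by (simp add: strand_pos_first)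
  have P_period: "?P (n + r) = ?P n" and Q_period: "?Q (n + r) = ?Q n" for n
    using G.strand_pos_period arevs uv by auto
  have P_D: "fst (?P n) \<in> D" if "?A \<le> n" "n < r" for n
  proof (rule strand_pos_in_D[where E = "{arev G x}" and k = ?A])
    show "\<exists>m<?A. (d, p) = ?P m" if "d \<in> {arev G x}" "p < mult G d" for d p
      using that P_first mult_arev by auto
    show "arcs_at G (tail G (arev G x)) - D \<subseteq> {arev G x}"
      using arevs uv xy by (auto simp: arcs_at_def D_def)
  qed (use that arevs uv in auto)
  have Q_D: "fst (?Q n) \<in> D" if "?B \<le> n" "n < r" for n
  proof (rule strand_pos_in_D[where E = "{arev G y}" and k = ?B])
    show "\<exists>m<?B. (d, p) = ?Q m" if "d \<in> {arev G y}" "p < mult G d" for d p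
      using that Q_first mult_arev by auto
    show "arcs_at G (tail G (arev G y)) - D \<subseteq> {arev G y}"
      using arevs uv xy by (auto simp: arcs_at_def D_def)
  qed (use that arevs uv in auto)
  have Q_B: "?Q ?B = (e, 0)" and P_A: "?P ?A = (cw G (arev G x), 0)"
    using strand_pos_mult_add[of G "arev G y" 0] strand_pos_mult_add[of G "arev G x" 0]
      mult_arev AB_pos by (simp_all add: e_def strand_pos_def)
  have e: "e \<in> D" "tail G e = u'"
    using Q_D[of ?B] Q_B AB AB_pos G.strand_pos_in(2)[OF arevs(2), of ?B] arevs by auto
  then have e': "e \<in> arcs G'" "tail G' e = u"
    using same[of e] D_in' by (auto simp: D_def u_def u'_def)
  have M_low: "?M n = ?Q (?B + n)" if "n < ?A" for n
    using strand_pos_same[of e 0 "arev G y" ?B n] Q_D Q_B AB that by (simp add: strand_pos_def)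
  have M_A: "?M ?A = ?P ?A"
  proof -
    obtain k where k: "?A = Suc k" using AB_pos by (metis Suc_pred)
    obtain d p where dp: "?Q (?B + k) = (d, p)" by fastforce
    have d: "d \<in> D" using Q_D[of "?B + k"] dp AB k by simp
    have "cw_strand G (d, p) = ?Q (0 + r)"
      using AB k by (simp flip: dp add: cw_strand_strand_pos add.commute)
    then have "cw_strand G (d, p) = (arev G y, 0)"
      unfolding Q_period using Q_first[of 0] AB_pos by simp
    then have "\<not> Suc p < mult G d" "cw G d = arev G y" using d by (auto simp: cw_strand_def D_def split: if_splits)
    then have "cw_strand G' (d, p) = (cw G (arev G x), 0)"
      using same[of d] d uv arevs by (auto simp: D_def cw_strand_def)
    then show ?thesis using P_A M_low[of k] k dp by (simp flip: cw_strand_strand_pos)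
  qed
  have M_high: "?M n = ?P n" if "?A \<le> n" "n < r" for n
    using strand_pos_same[of e ?A "arev G x" ?A "n - ?A"] M_A P_D that by simp
  have M_period: "?M (n + r) = ?M n" for n
    using G'.strand_pos_period e' uv boundary' by simp
  define k where "k = turn G r i u"
  have k: "0 < k" "k < r" using assms by (auto simp: k_def turn_def)
  have turns: "turn G r i u' = k" "turn G r i z = r - k" "turn G' r i u = k"
  proof -
    have "u \<in> verts G'" using e' G'.tail_in by blast
    then show "turn G r i u' = k" "turn G r i z = r - k" "turn G' r i u = k"
      using white_u white' assms by (auto simp: turn_def k_def)
  qed
  have step_P: "trip_step G i s (?P (n + k))" if "s \<in> strands G" "rev_strand G s = ?P n" for s n
    using G.trip_step_strand_pos[OF that, where i = i] arevs uv assms by (simp add: k_def)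
  have step_Q: "trip_step G i s (?Q (n + k))" if "s \<in> strands G" "rev_strand G s = ?Q n" for s n
    using G.trip_step_strand_pos[OF that, where i = i] arevs uv assms turns by simp
  have step_M: "trip_step G' i s (?M (n + k))" if "s \<in> strands G'" "rev_strand G' s = ?M n" for s n
    using G'.trip_step_strand_pos[OF that, where i = i] e' uv assms turns boundary' by simp
  have in_z: "trip_step G i (arev G a, n) (strand_pos G a (n + (r - k)))"
    if "a = x \<or> a = y" "n < mult G a" for a n
  proof -
    have "rev_strand G (arev G a, n) = strand_pos G a n" "(arev G a, n) \<in> strands G"
      using that xy G.mult_arev by (auto simp: rev_strand_def strand_pos_first strands_def)
    from G.trip_step_strand_pos[OF this(2,1), where i = i] show ?thesis
      using that xy z(2) assms turns by auto
  qed
  have out_x: "trip_step G i (x, n) (?P (n + k))" if "n < ?A" for n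
    using that xy by (intro step_P) (auto simp: strands_def rev_strand_def P_first)
  have out_y: "trip_step G i (y, n) (?Q (n + k))" if "n < ?B" for n
    using that xy by (intro step_Q) (auto simp: strands_def rev_strand_def Q_first)
  \<comment> \<open>The turn at \<open>u\<close> wraps and stops on strand \<open>n\<close> of
    \<open>arev G x\<close>. At \<open>z\<close> it is carried to position
    \<open>n + (r - k) = m\<close>, which is past the \<open>?A\<close> strands of \<open>x\<close>
    and so on \<open>y\<close>; at \<open>u'\<close> the last turn ends at \<open>?B + n\<close>,
    which is position \<open>n\<close> of \<open>?M\<close>.\<close>
  have via_x: "(trip_step G i)\<^sup>+\<^sup>+ s (?M n)"
    if s: "s \<in> strands G" "rev_strand G s = ?P m" and m: "?A \<le> m" "m < r" "m + k = n + r" "n < ?A" for s m n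
  proof -
    have "trip_step G i s (arev G x, n)"
      using step_P[OF s] m P_period[of n] P_first[of n] by simp
    moreover have "strand_pos G x (n + (r - k)) = (y, m - ?A)"
    proof -
      have "n + (r - k) = ?A + (m - ?A)" using m k by simp
      moreover have "m - ?A < ?B" using m AB by simp
      ultimately show ?thesis
        using strand_pos_mult_add[of G x "m - ?A"] AB_pos by (simp add: cw_x strand_pos_first)
    qed
    then have "trip_step G i (arev G x, n) (y, m - ?A)" using in_z[of x n] m by simp
    moreover have "trip_step G i (y, m - ?A) (?M n)"
    proof -
      have "m - ?A + k = ?B + n" "m - ?A < ?B" using m AB by simp_all
      then show ?thesis using out_y[of "m - ?A"] M_low m by simp
    qed
    ultimately show ?thesis by (blast intro: tranclp.intros)
  qed
  \<comment> \<open>The mirror case: the turn at \<open>u'\<close> wraps into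
    \<open>arev G y\<close>, \<open>z\<close> sends the trip back along strand \<open>n\<close> of
    \<open>x\<close>, and the turn at \<open>u\<close> ends at position
    \<open>n + k\<close>.\<close>
  have via_y: "(trip_step G i)\<^sup>+\<^sup>+ s (?M (n + k))"
    if s: "s \<in> strands G" "rev_strand G s = ?Q (?B + n)" and n: "n < ?A" "?A \<le> n + k" "n + k < r" for s n
  proof -
    have "?B + n + k = (n + k - ?A) + r" "n + k - ?A < ?B" using n AB by simp_all
    then have "trip_step G i s (arev G y, n + k - ?A)"
      using step_Q[OF s] Q_period[of "n + k - ?A"] Q_first[of "n + k - ?A"] by simp
    moreover have "strand_pos G y (n + k - ?A + (r - k)) = (x, n)"
    proof -
      have "n + k - ?A + (r - k) = ?B + n" using n k AB by simp
      then show ?thesis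
        using strand_pos_mult_add[of G y n] AB_pos n by (simp add: cw_y strand_pos_first)
    qed
    then have "trip_step G i (arev G y, n + k - ?A) (x, n)"
      using in_z[of y "n + k - ?A"] \<open>n + k - ?A < ?B\<close> by simp
    moreover have "trip_step G i (x, n) (?M (n + k))" using out_x[of n] n M_high by simp
    ultimately show ?thesis by (blast intro: tranclp.intros)
  qed
  show ?thesis
  proof (rule strand_trip_eq)
    fix s assume s: "s \<in> strands G" "fst s \<in> D" and "head G (fst s) \<notin> boundary G"
      and "\<not> arcs_at G (head G (fst s)) \<subseteq> D"
    then obtain d where "d \<in> arcs G - D" "tail G d = head G (fst s)" by (auto simp: arcs_at_def)
    then have hd: "head G (fst s) = u \<or> head G (fst s) = u'"
      using D_head[OF s(2)] arevs xy by (auto simp: D_def)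
    have s': "s \<in> strands G'" "rev_strand G' s = rev_strand G s"
      using s strands_same rev_strand_same by auto
    have rev: "rev_strand G s \<in> strands G" "tail G (fst (rev_strand G s)) = head G (fst s)"
        "fst (rev_strand G s) \<in> D"
      using G.rev_strand_in s D_notin by (auto simp: rev_strand_def split: prod.splits)
    have M_D: "fst (?M n) \<in> D" if "n < r" for n
      using that M_low[of n] M_high[of n] P_D[of n] Q_D[of "?B + n"] AB by (cases "n < ?A") auto
    show "\<exists>t. fst t \<in> D \<and> (trip_step G i)\<^sup>+\<^sup>+ s t \<and> (trip_step G' i)\<^sup>+\<^sup>+ s t"
      using hd
    proof
      assume "head G (fst s) = u"
      then obtain m where m: "m < r" "rev_strand G s = ?P m"
        using G.strand_pos_surj[OF arevs(1)] rev arevs uv by metis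
      have mA: "?A \<le> m" using m rev P_first[of m] by (cases "m < ?A") (auto simp: D_def)
      have M: "trip_step G' i s (?M (m + k))" using step_M s' m M_high[OF mA] by simp
      show ?thesis
      proof (cases "m + k < r")
        case True
        then have "trip_step G i s (?M (m + k))" using step_P[OF s(1) m(2)] M_high mA by simp
        then show ?thesis using M M_D[OF True] by blast
      next
        case False
        then obtain n where n: "m + k = n + r" using le_Suc_ex by (metis add.commute not_less)
        then have M': "trip_step G' i s (?M n)" "n < r" using M M_period[of n] m k by simp_all
        have "(trip_step G i)\<^sup>+\<^sup>+ s (?M n)"
        proof (cases "n < ?A")
          case True
          then show ?thesis using via_x s m mA n by blast
        next
          case False
          then have "trip_step G i s (?M n)"
            using step_P[OF s(1) m(2)] M_high n P_period[of n] M' by simp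
          then show ?thesis by blast
        qed
        then show ?thesis using M' M_D by blast
      qed
    next
      assume "head G (fst s) = u'"
      then obtain l where l: "l < r" "rev_strand G s = ?Q l"
        using G.strand_pos_surj[OF arevs(2)] rev arevs uv by metis
      have "?B \<le> l" using l rev Q_first[of l] by (cases "l < ?B") (auto simp: D_def)
      then obtain n where n: "l = ?B + n" using le_Suc_ex by blast
      then have nA: "n < ?A" using l AB by simp
      have M: "trip_step G' i s (?M (n + k))" using step_M s' l M_low[OF nA] n by simp
      have Q: "trip_step G i s (?Q (?B + n + k))" using step_Q[OF s(1)] l n by simp
      \<comment> \<open>The turn stays among the strands of \<open>u'\<close>, ends among those of
        \<open>u\<close>, or passes over all of the latter. In the last case the trip in
        \<open>G\<close> passes over all strands of \<open>arev G y\<close> and remains at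
        \<open>u'\<close>.\<close>
      consider "n + k < ?A" | "?A \<le> n + k" "n + k < r" | "r \<le> n + k" by linarith
      then show ?thesis
      proof cases
        case 1
        then have "trip_step G i s (?M (n + k))" using Q M_low[of "n + k"] by (simp add: add.assoc)
        then show ?thesis using M M_D[of "n + k"] 1 AB by (meson tranclp.r_into_trancl trans_less_add1)
      next
        case 2
        then show ?thesis using via_y[OF s(1)] l n nA M M_D[of "n + k"] by blast
      next
        case 3
        then obtain h where h: "n + k = h + r" using le_Suc_ex by (metis add.commute)
        then have "h < ?A" using nA k by simp
        then have "trip_step G i s (?M h)"
          using Q M_low[of h] Q_period[of "?B + h"] h by (simp add: add.assoc)
        moreover have "trip_step G' i s (?M h)" using M M_period[of h] h by simp
        moreover have "h < r" using \<open>h < ?A\<close> AB by simp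
        ultimately show ?thesis using M_D by blast
      qed
    qed
  qed
qed

section \<open>Square moves\<close>

text \<open>Brings every index modulo four to the form \<open>j\<close>, \<open>j + 1\<close>,
  \<open>j + 2\<close> or \<open>j + 3\<close>, so that the multiplicities around the square become
  four plain naturals.\<close>

lemma add_four [simp]:
  fixes j :: 4
  shows "j + 1 + 1 = j + 2" "j + 1 + 2 = j + 3" "j + 1 + 3 = j"
    "j + 2 + 1 = j + 3" "j + 2 + 2 = j" "j + 2 + 3 = j + 1"
    "j + 3 + 1 = j" "j + 3 + 2 = j + 1" "j + 3 + 3 = j + 2" "j - 1 = j + 3"
  by (simp_all add: add.assoc diff_eq_eq)

lemma sum_four: "(\<Sum>i\<in>UNIV. m i) = m j + m (j + 1) + m (j + 2) + m (j + 3)"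
  for m :: "4 \<Rightarrow> nat"
proof -
  have "card {0, 1, 2, 3 :: 4} = CARD(4)" by simp
  then have U: "UNIV = {0, 1, 2, 3 :: 4}" by (metis card_subset_eq finite subset_UNIV)
  have "(\<Sum>i\<in>UNIV. m i) = (\<Sum>i\<in>UNIV. m (j + i))"
    by (rule sum.reindex_bij_betw[symmetric]) (simp add: bij_betw_def)
  then show ?thesis unfolding U by (simp add: add_ac)
qed

text \<open>
  Here \<open>P j\<close>, \<open>M j\<close> and \<open>W j\<close> run clockwise around \<open>v\<^sub>j\<close> in \<open>G\<close>, \<open>v\<^sub>j\<close> in \<open>G'\<close> and \<open>w\<^sub>j\<close>, starting with
  the strands of \<open>a j\<close>, \<open>b j\<close> and \<open>arev (b j)\<close>, and \<open>K j\<close> is the clockwise turn at \<open>v\<^sub>j\<close>.  The positions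
  around \<open>v\<^sub>j\<close> from \<open>m j + m (j + 3)\<close> on lead out of the square; a trip that comes in along one of them
  and turns into the square does so at a position \<open>x\<close> as in the last three assumptions.
\<close>

lemma square_trip:
  fixes m K :: "4 \<Rightarrow> nat" and P M W :: "4 \<Rightarrow> nat \<Rightarrow> 's"
  assumes sum: "\<And>j. m j + m (j + 1) + m (j + 2) + m (j + 3) = r"
    and K: "\<And>j. 0 < K j \<and> K j < r" "\<And>j. K (j + 1) = r - K j"
    and P_period: "\<And>j n. P j (n + r) = P j n" and W_period: "\<And>j n. W j (n + r) = W j n"
    and P_right: "\<And>j n. n < m j \<Longrightarrow> R (P j n) (P (j + 1) (m (j + 1) + n + K (j + 1)))"
    and P_left: "\<And>j n. n < m (j + 3) \<Longrightarrow> R (P j (m j + n)) (P (j + 3) (n + K (j + 3)))"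
    and M_down: "\<And>j n. n < m j + m (j + 3) \<Longrightarrow> S (M j n) (W j (n + K (j + 1)))"
    and W_up: "\<And>j n. n < m j + m (j + 3) \<Longrightarrow> S (W j n) (M j (n + K j))"
    and W_right: "\<And>j n. n < m (j + 2) \<Longrightarrow>
      S (W j (m j + m (j + 3) + n)) (W (j + 1) (m j + m (j + 1) + m (j + 3) + n + K j))"
    and W_left: "\<And>j n. n < m (j + 1) \<Longrightarrow>
      S (W j (m j + m (j + 3) + m (j + 2) + n)) (W (j + 3) (m (j + 2) + m (j + 3) + n + K j))"
    and x: "x < m j + m (j + 3)" "m j + m (j + 3) + K j \<le> x + r" "x < K j"
  shows "\<exists>j' n. m j' + m (j' + 3) \<le> n \<and> n < r \<and> R\<^sup>+\<^sup>+ (P j x) (P j' n) \<and> S\<^sup>+\<^sup>+ (M j x) (M j' n)"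
proof -
  define m0 m1 m2 m3 k where defs: "m0 = m j" "m1 = m (j + 1)" "m2 = m (j + 2)" "m3 = m (j + 3)" "k = K j"
  have r: "r = m0 + m1 + m2 + m3" using sum[of j] by (simp add: defs)
  have k: "0 < k" "k < r" using K(1)[of j] by (simp_all add: defs)
  have Ks: "K j = k" "K (j + 1) = r - k" "K (j + 2) = k" "K (j + 3) = r - k"
    using K(2)[of j] K(2)[of "j + 1"] K(2)[of "j + 2"] k by (simp_all add: defs)
  note ms = defs(1-4)[symmetric]
  have x': "x < m0 + m3" "m0 + m3 + k \<le> x + r" "x < k" using x by (simp_all add: defs)
  have down: "S (M j x) (W j (x + (r - k)))"
    using M_down[of x j] x' by (simp add: Ks ms)
  show ?thesis
  proof (cases "x < m0")
    case True
    have first: "R (P j x) (P (j + 1) (m1 + x + (r - k)))"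
      using P_right[of x j] True by (simp add: Ks ms)
    show ?thesis
    \<comment> \<open>In \<open>G\<close> this says that the turn at \<open>v (j + 1)\<close> does
      not wrap and so leaves the square. In \<open>G'\<close> it says that the turn at
      \<open>w j\<close> stops within the \<open>m2\<close> strands of \<open>c j\<close> and does
      not reach \<open>arev (c (j + 3))\<close>.\<close>
    proof (cases "m1 + x < k")
      case A: True
      define q where "q = x + (r - k) - (m0 + m3)"
      have q: "x + (r - k) = m0 + m3 + q" "q < m2" "m0 + m1 + m3 + q + k = (m1 + x) + r"
        using x' k r A by (simp_all add: q_def)
      have "S (W j (x + (r - k))) (W (j + 1) (m1 + x))"
        using W_right[of q j] q W_period[of "j + 1" "m1 + x"] by (simp add: Ks ms)
      moreover have "S (W (j + 1) (m1 + x)) (M (j + 1) (m1 + x + (r - k)))"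
        using W_up[of "m1 + x" "j + 1"] True by (simp add: Ks ms)
      ultimately have "S\<^sup>+\<^sup>+ (M j x) (M (j + 1) (m1 + x + (r - k)))"
        using down by (blast intro: tranclp.intros)
      then show ?thesis using first x' k r A
        by (intro exI[of _ "j + 1"] exI[of _ "m1 + x + (r - k)"]) (auto simp: ms)
    next
      case A: False
      \<comment> \<open>\<open>q\<close> is the strand of \<open>a (j + 1)\<close> taken in
        \<open>G\<close>, and also the strand of \<open>arev (c (j + 3))\<close> taken in
        \<open>G'\<close>. The two trips reach the opposite corner on different sides: by
        \<open>v (j + 1)\<close> in \<open>G\<close>, by \<open>w (j + 3)\<close> in
        \<open>G'\<close>.\<close>
      define q where "q = m1 + x - k"
      have q: "m1 + x + (r - k) = q + r" "q < m1" "m2 + q + k = m1 + m2 + x"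
        "x + (r - k) = m0 + m3 + m2 + q" "m2 + m3 + q + k = m3 + m2 + m1 + x"
        using x' k r A by (simp_all add: q_def)
      have "R (P (j + 1) q) (P (j + 2) (m1 + m2 + x))"
        using P_right[of q "j + 1"] q by (simp add: Ks ms)
      then have R: "R\<^sup>+\<^sup>+ (P j x) (P (j + 2) (m1 + m2 + x))"
        using first q(1) P_period[of "j + 1" q] by (auto intro: tranclp.intros)
      have "S (W j (x + (r - k))) (W (j + 3) (m3 + m2 + m1 + x))"
        using W_left[of q j] q by (simp add: Ks ms)
      moreover have "S (W (j + 3) (m3 + m2 + m1 + x)) (W (j + 2) (m1 + m2 + x + (r - k)))"
        using W_left[of x "j + 3"] True by (simp add: Ks ms)
      moreover have "m1 + m2 + x + (r - k) = (m2 + q) + r" using q by simp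
      then have "W (j + 2) (m1 + m2 + x + (r - k)) = W (j + 2) (m2 + q)"
        using W_period by metis
      moreover have "S (W (j + 2) (m2 + q)) (M (j + 2) (m1 + m2 + x))"
        using W_up[of "m2 + q" "j + 2"] q by (simp add: Ks ms)
      ultimately have "S\<^sup>+\<^sup>+ (M j x) (M (j + 2) (m1 + m2 + x))"
        using down by (auto intro: tranclp.intros)
      then show ?thesis using R True r
        by (intro exI[of _ "j + 2"] exI[of _ "m1 + m2 + x"]) (auto simp: ms)
    qed
  next
    case False
    define q where "q = x - m0"
    have q: "x = m0 + q" "q < m3" "q < k" "m3 + k \<le> q + r" using False x' r by (simp_all add: q_def)
    have first: "R (P j x) (P (j + 3) (q + (r - k)))"
      using P_left[of q j] q by (simp add: Ks ms)
    show ?thesis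
    \<comment> \<open>As \<open>q < k\<close>, the turn at \<open>v (j + 3)\<close> cannot wrap; the
      assumption on \<open>x\<close> puts it past the \<open>m3\<close> strands of
      \<open>a (j + 3)\<close>. What remains is whether it clears the \<open>m2\<close> strands of
      \<open>arev (a (j + 2))\<close> and leaves.\<close>
    proof (cases "m3 + m2 \<le> q + (r - k)")
      case B: True
      define p where "p = q + (r - k) - (m3 + m2)"
      have p: "x + (r - k) = m0 + m3 + m2 + p" "p < m1" "m2 + m3 + p + k = q + r"
        using q k r B x' by (simp_all add: p_def)
      have "S (W j (x + (r - k))) (W (j + 3) q)"
        using W_left[of p j] p W_period[of "j + 3" q] by (simp add: Ks ms)
      moreover have "S (W (j + 3) q) (M (j + 3) (q + (r - k)))"
        using W_up[of q "j + 3"] q by (simp add: Ks ms)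
      ultimately have "S\<^sup>+\<^sup>+ (M j x) (M (j + 3) (q + (r - k)))"
        using down by (blast intro: tranclp.intros)
      then show ?thesis using first q k B
        by (intro exI[of _ "j + 3"] exI[of _ "q + (r - k)"]) (auto simp: ms)
    next
      case B: False
      define p where "p = q + (r - k) - m3"
      \<comment> \<open>\<open>h\<close> is the strand by which the trip in \<open>G'\<close> goes
        up from \<open>w (j + 2)\<close>, reached by \<open>w j\<close>, \<open>w (j + 1)\<close>,
        \<open>w (j + 2)\<close>; the trip in \<open>G\<close> goes round the other side, by
        \<open>v (j + 3)\<close>.\<close>
      define h where "h = m0 + m1 + m2 + q - k"
      have p: "q + (r - k) = m3 + p" "p < m2" "p + k = m0 + m1 + m2 + q"
        "x + (r - k) = m0 + m3 + p" "m0 + m1 + m3 + p + k = (m1 + m0 + q) + r"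
        "m1 + m2 + m0 + q + (r - k) = h + r" "h < m1 + m2" "h + k = m0 + m1 + m2 + q"
        using q k r B x' by (simp_all add: p_def h_def)
      have "R (P (j + 3) (m3 + p)) (P (j + 2) (m0 + m1 + m2 + q))"
        using P_left[of p "j + 3"] p by (simp add: Ks ms)
      then have R: "R\<^sup>+\<^sup>+ (P j x) (P (j + 2) (m0 + m1 + m2 + q))"
        using first p(1) by (auto intro: tranclp.intros)
      have "S (W j (x + (r - k))) (W (j + 1) (m1 + m0 + q))"
        using W_right[of p j] p W_period[of "j + 1" "m1 + m0 + q"] by (simp add: Ks ms)
      moreover have "S (W (j + 1) (m1 + m0 + q)) (W (j + 2) h)"
        using W_right[of q "j + 1"] q p W_period[of "j + 2" h] by (simp add: Ks ms)
      moreover have "S (W (j + 2) h) (M (j + 2) (m0 + m1 + m2 + q))"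
        using W_up[of h "j + 2"] p by (simp add: Ks ms)
      ultimately have "S\<^sup>+\<^sup>+ (M j x) (M (j + 2) (m0 + m1 + m2 + q))"
        using down by (blast intro: tranclp.intros)
      then show ?thesis using R q r
        by (intro exI[of _ "j + 2"] exI[of _ "m0 + m1 + m2 + q"]) (auto simp: ms)
    qed
  qed
qed

lemma strand_trip_square_eq:
  assumes "square_move r G G'" "0 < i" "i < r"
  shows "strand_trip G i = strand_trip G' i"
proof -
  obtain a w b c where hg: "hourglass_plabic_graph r G" "hourglass_plabic_graph r G'"
    and a_in: "range a \<subseteq> arcs G" and v_inj: "inj (\<lambda>j :: 4. tail G (a j))"
    and head_a: "\<forall>j. head G (a j) = tail G (a (j + 1))"
    and cw_a: "\<forall>j. cw G (a (j + 1)) = arev G (a j)" and sum: "(\<Sum>j\<in>UNIV. mult G (a j)) = r"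
    and w: "inj w" "range w \<inter> verts G = {}"
    and new: "(range b \<union> range c \<union> arev G' ` (range b \<union> range c)) \<inter> arcs G = {}"
    and verts': "verts G' = verts G \<union> range w"
    and arcs': "arcs G' = (arcs G - (range a \<union> arev G ` range a)) \<union>
      (range b \<union> range c \<union> arev G' ` (range b \<union> range c))"
    and b: "\<forall>j. tail G' (b j) = tail G (a j) \<and> head G' (b j) = w j \<and>
      mult G' (b j) = mult G (a (j - 1)) + mult G (a j)"
    and c: "\<forall>j. tail G' (c j) = w j \<and> head G' (c j) = w (j + 1) \<and> mult G' (c j) = mult G (a (j + 2))"
    and cw_b: "\<forall>j. cw G' (b j) = cw G (arev G (a (j - 1)))"
    and cw_w: "\<forall>j. cw G' (arev G' (b j)) = c j \<and> cw G' (c j) = arev G' (c (j - 1)) \<and>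
               cw G' (arev G' (c (j - 1))) = arev G' (b j)"
    and same: "\<forall>d\<in>arcs G - (range a \<union> arev G ` range a).
             tail G' d = tail G d \<and> head G' d = head G d \<and> arev G' d = arev G d \<and>
             mult G' d = mult G d \<and>
             (\<forall>i. cw G d = a i \<longrightarrow> cw G' d = b i) \<and>
             (cw G d \<notin> range a \<longrightarrow> cw G' d = cw G d)"
    and white': "\<forall>x\<in>verts G. white G' x = white G x"
    and white_w: "\<forall>j. white G' (w j) \<longleftrightarrow> \<not> white G (tail G (a j))"
    and bnum': "bnum G' = bnum G" and bvert': "\<forall>j\<in>{1..bnum G}. bvert G' j = bvert G j"
    using assms(1) unfolding square_move_def Let_def by (elim conjE exE) (rule that; assumption)
  interpret G: hourglass_plabic_graph r G by fact
  interpret G': hourglass_plabic_graph r G' by fact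
  define v where "v j = tail G (a j)" for j
  define m where "m j = mult G (a j)" for j
  define D where "D = arcs G - (range a \<union> arev G ` range a)"
  have a_arcs: "a j \<in> arcs G" for j using a_in by auto
  have a: "a j \<in> arcs G" "tail G (a j) = v j" "head G (a j) = v (j + 1)" "mult G (a j) = m j"
    "arev G (a j) \<in> arcs G" "tail G (arev G (a j)) = v (j + 1)" "head G (arev G (a j)) = v j"
    "mult G (arev G (a j)) = m j" "cw G (a j) = arev G (a (j + 3))" for j
    using a_arcs head_a G.mult_arev[of "a j"] spec[OF cw_a, of "j + 3"] by (simp_all add: v_def m_def)
  have m_pos: "0 < m j" for j using G.mult_pos a by metis
  have b_in: "b j \<in> arcs G'" and c_in: "c j \<in> arcs G'" for j using arcs' by auto
  have b: "tail G' (b j) = v j" "head G' (b j) = w j" "mult G' (b j) = m j + m (j + 3)"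
    "arev G' (b j) \<in> arcs G'" "tail G' (arev G' (b j)) = w j" "head G' (arev G' (b j)) = v j"
    "mult G' (arev G' (b j)) = m j + m (j + 3)"
    "cw G' (b j) = cw G (arev G (a (j + 3)))" "cw G' (arev G' (b j)) = c j" for j
    using b_in b cw_b cw_w G'.mult_arev by (simp_all add: v_def m_def)
  have c: "tail G' (c j) = w j" "head G' (c j) = w (j + 1)" "mult G' (c j) = m (j + 2)"
    "arev G' (c j) \<in> arcs G'" "tail G' (arev G' (c j)) = w (j + 1)" "head G' (arev G' (c j)) = w j"
    "mult G' (arev G' (c j)) = m (j + 2)"
    "cw G' (c j) = arev G' (c (j + 3))" for j
    using c_in c cw_w G'.mult_arev by (simp_all add: v_def m_def)
  have v_inj: "v j = v l \<longleftrightarrow> j = l" for j l using v_inj by (auto simp: inj_def v_def)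
  have v_in: "v j \<in> verts G" for j using a G.tail_in by metis
  have boundary': "boundary G' = boundary G" using bnum' bvert' by (auto simp: boundary_def)
  have w_boundary: "w j \<notin> boundary G" for j
  proof -
    have "boundary G \<subseteq> verts G" using G.bvert_in_verts by (auto simp: boundary_def)
    then show ?thesis using w(2) by blast
  qed
  have v_boundary: "v j \<notin> boundary G" for j
  proof
    assume "v j \<in> boundary G"
    then obtain d where d: "arcs_at G (v j) = {d}"
      using G.boundary_simple_degree card_1_singletonE by metis
    have "a j \<in> arcs_at G (v j)" "arev G (a (j + 3)) \<in> arcs_at G (v j)"
      using a[of j] a[of "j + 3"] by (simp_all add: arcs_at_def)
    then have "a j = arev G (a (j + 3))" using d by simp
    then have "v (j + 1) = v (j + 3)" using a[of j] a[of "j + 3"] by metis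
    then show False using v_inj by simp
  qed
  have old_D: "arev G d \<in> D" if "d \<in> D" for d
    using that unfolding D_def by (auto simp: image_iff) (metis G.arev_arev)+
  have ends_new: "tail G' d \<in> range v \<union> range w \<and> head G' d \<in> range v \<union> range w"
    if "d \<in> arcs G'" "d \<notin> D" for d
  proof -
    have "d \<in> range b \<union> range c \<union> arev G' ` (range b \<union> range c)"
      using that unfolding arcs' D_def by blast
    then consider j where "d = b j" | j where "d = c j"
      | j where "d = arev G' (b j)" | j where "d = arev G' (c j)" by blast
    then show ?thesis by cases (simp_all add: b c)
  qed
  have same: "tail G' d = tail G d" "head G' d = head G d" "arev G' d = arev G d"
      "mult G' d = mult G d" "cw G d \<notin> range a \<Longrightarrow> cw G' d = cw G d" if "d \<in> D" for d
    using bspec[OF same, of d] that by (simp_all add: D_def)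
  interpret common_part r G G' D i
  proof
    show "white G' (head G' d) = white G (head G d)" if "d \<in> D" for d
      using same[OF that] white' that by (simp add: D_def)
    show "head G' d = bvert G' j \<longleftrightarrow> head G d = bvert G j" if "d \<in> D" "j \<in> {1..bnum G}" for d j
      using same[OF that(1)] bspec[OF bvert' that(2)] by simp
    show "head G d \<notin> boundary G \<and> tail G d \<notin> boundary G" if "d \<in> arcs G" "d \<notin> D" for d
      using that v_boundary a by (auto simp: D_def)
    show "head G' d \<notin> boundary G' \<and> tail G' d \<notin> boundary G'" if "d \<in> arcs G'" "d \<notin> D" for d
      using ends_new[OF that] v_boundary w_boundary boundary' by auto
    show "arev G d \<in> D" if "d \<in> D" for d using that by (rule old_D)
    show "d \<in> arcs G'" if "d \<in> D" for d using that arcs' by (simp add: D_def)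
    show "d \<in> arcs G" if "d \<in> D" for d using that by (simp add: D_def)
    show "cw G' d = cw G d" if "d \<in> D" "cw G d \<in> D" for d
      using same(5)[OF that(1)] that(2) by (auto simp: D_def)
  qed (use assms same bnum' in simp_all)
  have sum: "m j + m (j + 1) + m (j + 2) + m (j + 3) = r" for j
    using sum sum_four[of m j] by (simp add: m_def)
  define P where "P j = strand_pos G (a j)" for j
  define M where "M j = strand_pos G' (b j)" for j
  define W where "W j = strand_pos G' (arev G' (b j))" for j
  define K where "K j = turn G r i (v j)" for j
  have K: "0 < K j" "K j < r" "K (j + 1) = r - K j" for j
    using assms G.bipartite[of "a j"] a[of j] by (auto simp: K_def turn_def)
  \<comment> \<open>The vertex \<open>w j\<close> has the color opposite to \<open>v j\<close>,
    hence that of \<open>v (j + 1)\<close>, and so its turn is \<open>K (j + 1)\<close>.\<close>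
  have turns: "turn G' r i (v j) = K j" "turn G' r i (w j) = K (j + 1)" for j
    using assms K(3)[of j] white' white_w v_in by (auto simp: K_def turn_def v_def)
  have P_period: "P j (n + r) = P j n" for j n
    using G.strand_pos_period a v_boundary by (simp add: P_def)
  have M_period: "M j (n + r) = M j n" and W_period: "W j (n + r) = W j n" for j n
    using G'.strand_pos_period b_in b v_boundary w_boundary boundary' by (simp_all add: M_def W_def)
  have P_a: "P j n = (a j, n)" if "n < m j" for j n
    using that a by (simp add: P_def strand_pos_first)
  have P_arev: "P j (m j + n) = (arev G (a (j + 3)), n)" if "n < m (j + 3)" for j n
    using that strand_pos_mult_add[of G "a j" n] a m_pos by (simp add: P_def strand_pos_first)
  have M_b: "M j n = (b j, n)" if "n < m j + m (j + 3)" for j n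
    using that b by (simp add: M_def strand_pos_first)
  have W_b: "W j n = (arev G' (b j), n)" if "n < m j + m (j + 3)" for j n
    using that b by (simp add: W_def strand_pos_first)
  have W_shift: "W j (m j + m (j + 3) + n) = strand_pos G' (c j) n" for j n
    using strand_pos_mult_add[of G' "arev G' (b j)" n] b m_pos by (simp add: W_def)
  have W_c: "W j (m j + m (j + 3) + n) = (c j, n)" if "n < m (j + 2)" for j n
    using that c by (simp add: W_shift strand_pos_first)
  have W_arev: "W j (m j + m (j + 3) + m (j + 2) + n) = (arev G' (c (j + 3)), n)"
    if "n < m (j + 1)" for j n
  proof -
    have "W j (m j + m (j + 3) + (m (j + 2) + n)) = strand_pos G' (arev G' (c (j + 3))) n"
      using W_shift strand_pos_mult_add[of G' "c j" n] c[of j] m_pos by simp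
    moreover have "mult G' (arev G' (c (j + 3))) = m (j + 1)" using c(7)[of "j + 3"] by simp
    ultimately show ?thesis using that by (simp only: strand_pos_first add.assoc)
  qed
  have step_P: "trip_step G i s (P j (n + K j))"
    if "s \<in> strands G" "rev_strand G s = P j n" for s j n
    using G.trip_step_strand_pos[of s "a j" n i] that a v_boundary assms by (simp add: P_def K_def)
  have step_M: "trip_step G' i s (M j (n + K j))"
    if "s \<in> strands G'" "rev_strand G' s = M j n" for s j n
    using G'.trip_step_strand_pos[of s "b j" n i] that b b_in v_boundary boundary' assms turns
    by (simp add: M_def)
  have step_W: "trip_step G' i s (W j (n + K (j + 1)))"
    if "s \<in> strands G'" "rev_strand G' s = W j n" for s j n
    using G'.trip_step_strand_pos[of s "arev G' (b j)" n i] that b w_boundary boundary' assms turns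
    by (simp add: W_def)
  have square: "\<exists>j' n. m j' + m (j' + 3) \<le> n \<and> n < r \<and>
      (trip_step G i)\<^sup>+\<^sup>+ (P j x) (P j' n) \<and> (trip_step G' i)\<^sup>+\<^sup>+ (M j x) (M j' n)"
    if "x < m j + m (j + 3)" "m j + m (j + 3) + K j \<le> x + r" "x < K j" for j x
  proof (rule square_trip[where m = m and K = K and P = P and W = W and r = r, OF sum _ K(3) P_period W_period])
    show "0 < K j \<and> K j < r" for j using K by simp
    show "trip_step G i (P j n) (P (j + 1) (m (j + 1) + n + K (j + 1)))" if "n < m j" for j n
      using that a P_a[of n j] P_arev[of n "j + 1"]
      by (intro step_P) (auto simp: strands_def rev_strand_def)
    show "trip_step G i (P j (m j + n)) (P (j + 3) (n + K (j + 3)))" if "n < m (j + 3)" for j n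
      using that a P_a[of n "j + 3"] P_arev[of n j]
      by (intro step_P) (auto simp: strands_def rev_strand_def)
    show "trip_step G' i (M j n) (W j (n + K (j + 1)))" if "n < m j + m (j + 3)" for j n
      using that b_in b M_b W_b by (intro step_W) (auto simp: strands_def rev_strand_def)
    show "trip_step G' i (W j n) (M j (n + K j))" if "n < m j + m (j + 3)" for j n
      using that b_in b M_b W_b by (intro step_M) (auto simp: strands_def rev_strand_def)
    show "trip_step G' i (W j (m j + m (j + 3) + n)) (W (j + 1) (m j + m (j + 1) + m (j + 3) + n + K j))"
      if n: "n < m (j + 2)" for j n
    proof -
      have "W (j + 1) (m j + m (j + 1) + m (j + 3) + n) = (arev G' (c j), n)"
        using W_arev[of n "j + 1"] n by (simp add: add.commute[of "m (j + 1)" "m j"])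
      then have "trip_step G' i (c j, n) (W (j + 1) (m j + m (j + 1) + m (j + 3) + n + K (j + 1 + 1)))"
        using n c c_in by (intro step_W) (auto simp: strands_def rev_strand_def)
      moreover have "K (j + 1 + 1) = K j" using K(3)[of j] K(3)[of "j + 1"] K(2)[of j] by simp
      ultimately show ?thesis using W_c[OF n] by metis
    qed
    show "trip_step G' i (W j (m j + m (j + 3) + m (j + 2) + n)) (W (j + 3) (m (j + 2) + m (j + 3) + n + K j))"
      if n: "n < m (j + 1)" for j n
    proof -
      have "W (j + 3) (m (j + 2) + m (j + 3) + n) = (c (j + 3), n)"
        using W_c[of n "j + 3"] n by (simp add: add.commute[of "m (j + 3)" "m (j + 2)"])
      then have "trip_step G' i (arev G' (c (j + 3)), n)
          (W (j + 3) (m (j + 2) + m (j + 3) + n + K (j + 3 + 1)))"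
        using n c c_in by (intro step_W) (auto simp: strands_def rev_strand_def)
      then show ?thesis using W_arev[OF n] by simp
    qed
  qed (use that in auto)
  have P_D: "fst (P j n) \<in> D" if "m j + m (j + 3) \<le> n" "n < r" for j n
    unfolding P_def
  \<comment> \<open>The only edges of the square at \<open>v j\<close> lead to
    \<open>v (j + 1)\<close> and \<open>v (j + 3)\<close>. Starting at \<open>a j\<close> puts their
    strands first.\<close>
  proof (rule strand_pos_in_D[where E = "{a j, arev G (a (j + 3))}" and k = "m j + m (j + 3)"])
    show "\<exists>l<m j + m (j + 3). (d, p) = strand_pos G (a j) l"
      if "d \<in> {a j, arev G (a (j + 3))}" "p < mult G d" for d p
      using that P_a[of p j] P_arev[of p j] a m_pos
      by (metis P_def insertE singletonD trans_less_add1 add_strict_left_mono)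
    show "arcs_at G (tail G (a j)) - D \<subseteq> {a j, arev G (a (j + 3))}"
    proof
      fix d assume d: "d \<in> arcs_at G (tail G (a j)) - D"
      then have t: "tail G d = v j" and "d \<in> range a \<union> arev G ` range a"
        using a by (auto simp: arcs_at_def D_def)
      then consider l where "d = a l" | l where "d = arev G (a l)" by auto
      then show "d \<in> {a j, arev G (a (j + 3))}"
      proof cases
        case 1
        then show ?thesis using t a v_inj by auto
      next
        case 2
        then have "l + 1 = j" using t a v_inj by auto
        then have "l = j + 3" by auto
        then show ?thesis using 2 by simp
      qed
    qed
  qed (use that a v_boundary in auto)
  \<comment> \<open>The edge \<open>b j\<close> has the total multiplicity of the two square edges
    that it replaces at \<open>v j\<close>, and its successor is the one of
    \<open>arev G (a (j + 3))\<close>. Hence outer positions agree with no shift.\<close>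
  have M_P: "M j n = P j n" if "m j + m (j + 3) \<le> n" "n < r" for j n
  proof -
    have "strand_pos G (a j) (m j + m (j + 3)) = strand_pos G (arev G (a (j + 3))) (m (j + 3))"
      using strand_pos_mult_add[of G "a j"] a m_pos by simp
    also have "\<dots> = (cw G' (b j), 0)"
      using strand_pos_mult_add[of G "arev G (a (j + 3))" 0] a m_pos b by (simp add: strand_pos_def)
    also have "\<dots> = strand_pos G' (b j) (m j + m (j + 3))"
      using strand_pos_mult_add[of G' "b j" 0] b m_pos by (simp add: strand_pos_def)
    finally show ?thesis
      using strand_pos_same[of "b j" "m j + m (j + 3)" "a j" "m j + m (j + 3)" "n - (m j + m (j + 3))"]
        P_D[of j] that by (simp add: P_def M_def)
  qed
  show ?thesis
  proof (rule strand_trip_eq)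
    fix s assume s: "s \<in> strands G" "fst s \<in> D" and "head G (fst s) \<notin> boundary G"
      and "\<not> arcs_at G (head G (fst s)) \<subseteq> D"
    then obtain d where "d \<in> arcs G - D" "tail G d = head G (fst s)" by (auto simp: arcs_at_def)
    moreover have "tail G d \<in> range v" if "d \<in> arcs G - D" for d
      using that a by (auto simp: D_def)
    ultimately obtain j where j: "head G (fst s) = v j" by (metis rangeE)
    have s': "s \<in> strands G'" "rev_strand G' s = rev_strand G s"
      using s strands_same rev_strand_same by auto
    have rev: "rev_strand G s \<in> strands G" "tail G (fst (rev_strand G s)) = v j"
        "fst (rev_strand G s) \<in> D"
      using G.rev_strand_in s j arev_D by (auto simp: rev_strand_def split: prod.splits)
    obtain l where l: "l < r" "rev_strand G s = P j l"
      using G.strand_pos_surj[of "a j" "rev_strand G s"] rev a v_boundary by (auto simp: P_def)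
    have "m j + m (j + 3) \<le> l"
    proof (rule ccontr)
      assume "\<not> m j + m (j + 3) \<le> l"
      then have "fst (P j l) \<in> {a j, arev G (a (j + 3))}"
        using P_a[of l j] P_arev[of "l - m j" j] by (cases "l < m j") auto
      then show False using rev(3) l(2) by (auto simp: D_def)
    qed
    then have steps: "trip_step G i s (P j (l + K j))" "trip_step G' i s (M j (l + K j))"
      using step_P[OF s(1) l(2)] step_M[OF s'(1), of j l] s' l M_P by simp_all
    \<comment> \<open>One subtraction reduces the position because \<open>l\<close> and
      \<open>K j\<close> are both below \<open>r\<close>. Without a wrap the trip stays at outer
      positions, so it can enter the square only by wrapping.\<close>
    define x where "x = (if l + K j < r then l + K j else l + K j - r)"
    have x: "x < r" "x + r = l + K j \<or> x = l + K j" "x = l + K j \<longrightarrow> m j + m (j + 3) \<le> x"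
      using l K(2)[of j] \<open>m j + m (j + 3) \<le> l\<close> by (auto simp: x_def)
    have P_x: "trip_step G i s (P j x)" and M_x: "trip_step G' i s (M j x)"
      using steps x(2) P_period[of j x] M_period[of j x] by auto
    show "\<exists>t. fst t \<in> D \<and> (trip_step G i)\<^sup>+\<^sup>+ s t \<and> (trip_step G' i)\<^sup>+\<^sup>+ s t"
    proof (cases "m j + m (j + 3) \<le> x")
      case True
      then show ?thesis using P_x M_x M_P P_D x(1) by (metis tranclp.r_into_trancl)
    next
      case False
      then have "x + r = l + K j" using x by blast
      \<comment> \<open>From \<open>x + r = l + K j\<close>, the bound \<open>l < r\<close> gives
        \<open>x < K j\<close>, and arrival at an outer position gives the lower bound on
        \<open>x + r\<close>.\<close>
      then have "\<exists>j' n. m j' + m (j' + 3) \<le> n \<and> n < r \<and>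
          (trip_step G i)\<^sup>+\<^sup>+ (P j x) (P j' n) \<and> (trip_step G' i)\<^sup>+\<^sup>+ (M j x) (M j' n)"
        using False l(1) \<open>m j + m (j + 3) \<le> l\<close> by (intro square) auto
      then obtain j' n where n: "m j' + m (j' + 3) \<le> n" "n < r"
        and "(trip_step G i)\<^sup>+\<^sup>+ (P j x) (P j' n)" "(trip_step G' i)\<^sup>+\<^sup>+ (M j x) (M j' n)"
        by blast
      then have "(trip_step G i)\<^sup>+\<^sup>+ s (P j' n)" "(trip_step G' i)\<^sup>+\<^sup>+ s (M j' n)"
        using P_x M_x by (auto intro: tranclp_into_tranclp2)
      then show ?thesis using M_P[OF n] P_D[OF n] by metis
    qed
  qed
qed

section \<open>Composition of moves\<close>

text \<open>The induction also carries along that \<open>K\<close> is a plabic graph, which the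
  comparison of \<open>K\<close> with an isomorphic copy requires.\<close>

lemma strand_trip_contractions_eq:
  assumes "(contraction_move r)\<^sup>*\<^sup>* H K" "hourglass_plabic_graph r H" "0 < i" "i < r"
  shows "hourglass_plabic_graph r K \<and> strand_trip H i = strand_trip K i"
  using assms(1)
proof (induction rule: rtranclp_induct)
  case (step K L)
  then show ?case
    using strand_trip_contraction_eq[OF step(2) assms(3,4)] by (simp add: contraction_move_def)
qed (simp add: assms)

text \<open>Equality of trips is symmetric, so the result for a square move also covers its inverse;
  contractions and the isomorphism are then chained on.\<close>

lemma strand_trip_square_then_contractions_eq:
  assumes "square_then_contractions r G G'" "hourglass_plabic_graph r G'" "0 < i" "i < r"
  shows "strand_trip G i = strand_trip G' i"
proof -
  obtain H K where H: "square_move r G H \<or> square_move r H G"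
    and HK: "(contraction_move r)\<^sup>*\<^sup>* H K" and K: "hourglass_iso K G'"
    using assms(1) unfolding square_then_contractions_def by blast
  have "hourglass_plabic_graph r H" using H by (auto simp: square_move_def)
  then have "hourglass_plabic_graph r K" "strand_trip H i = strand_trip K i"
    using strand_trip_contractions_eq[OF HK] assms(3,4) by blast+
  moreover have "strand_trip G i = strand_trip H i"
    using H strand_trip_square_eq assms(3,4) by metis
  ultimately show ?thesis
    using strand_trip_iso_eq[OF _ assms(2) K, of i] assms(4) by simp
qed

text \<open>Boundary edges may have several strands. Equality of \<open>strand_trip\<close> tracks
  each of them, and \<open>trip\<close> is obtained from it by forgetting the strand
  indices.\<close>

theorem theorem5p7:
  fixes r :: nat and G G' :: "('v, 'a) hourglass_graph"
  assumes "hourglass_plabic_graph r G"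
    and "hourglass_plabic_graph r G'"
    and "related_by_square_move r G G'"
  shows "\<forall>i\<in>{1..r - 1}. trip G i = trip G' i \<and> strand_trip G i = strand_trip G' i"
proof
  fix i assume "i \<in> {1..r - 1}"
  then have "0 < i" "i < r" by auto
  then have "strand_trip G i = strand_trip G' i"
    using assms strand_trip_square_then_contractions_eq unfolding related_by_square_move_def by metis
  then show "trip G i = trip G' i \<and> strand_trip G i = strand_trip G' i" by (simp add: trip_def)
qed

end
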